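(* Let $\mathcal A\in\mathbb C^{m\times n\times p}$ be a complex tensor and $f:\mathbb C\to\mathbb C$ a scalar function. Denote by $f^{\Diamond}$ both the induced generalized tensor function on $\mathbb C^{m\times n\times p}$ and the induced generalized matrix function on $\mathbb C^{mp\times np}$. Then $f^{\Diamond}$ commutes with the block circulant operator $\mathrm{bcirc}$: $$f^{\Diamond}(\mathrm{bcirc}(\mathcal A))=\mathrm{bcirc}(f^{\Diamond}(\mathcal A)).$$
   Context: T-product. For $\mathcal A\in\mathbb C^{m\times n\times p}$ with frontal slices $A^{(1)},\dots,A^{(p)}\in\mathbb C^{m\times n}$, $\mathrm{unfold}(\mathcal A)\in\mathbb C^{mp\times n}$ is the vertical stack of $A^{(1)},\dots,A^{(p)}$, $\mathrm{fold}$ is its inverse, and $\mathrm{bcirc}(\mathcal A)\in\mathbb C^{mp\times np}$ is the block circulant matrix whose $(a,b)$ block is $A^{(((a-b)\bmod p)+1)}$; $\mathrm{bcirc}^{-1}$ is the inverse of $\mathrm{bcirc}$ on its image. For $\mathcal B\in\mathbb C^{n\times s\times p}$, $\mathcal A*\mathcal B=\mathrm{fold}(\mathrm{bcirc}(\mathcal A)\,\mathrm{unfold}(\mathcal B))$. $\mathcal A^H$ is obtained by conjugate transposing each frontal slice and reversing the order of slices $2,\dots,p$. The identity tensor has first frontal slice the identity matrix and other slices zero; $\mathcal Q$ is unitary if $\mathcal Q^H*\mathcal Q=\mathcal Q*\mathcal Q^H$ is the identity tensor. Generalized matrix function. For a matrix $M$ of rank $r$ with compact SVD $M=U_r\Sigma_rV_r^H$,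 $\Sigma_r=\mathrm{diag}(\sigma_1,\dots,\sigma_r)$, $\sigma_1\ge\dots\ge\sigma_r>0$, one sets $f^{\Diamond}(M)=U_r\,\mathrm{diag}(f(\sigma_1),\dots,f(\sigma_r))\,V_r^H$. Generalized tensor function. $F_p=p^{-1/2}(\omega^{jk})_{j,k=0}^{p-1}$ with $\omega=e^{-2\pi\mathbf i/p}$. A T-SVD is $\mathcal A=\mathcal U*\mathcal S*\mathcal V^H$ with $\mathcal U,\mathcal V$ unitary, $\mathcal S$ F-diagonal (every frontal slice diagonal) and $\mathrm{bcirc}(\mathcal S)=(F_p\otimes I_m)\mathrm{diag}(\Sigma_1,\dots,\Sigma_p)(F_p^H\otimes I_n)$, where each $\Sigma_i\in\mathbb R^{m\times n}$ is diagonal with nonnegative entries. For a scalar function $f$, $f^{\Diamond}(\mathcal A)=\mathcal U*\hat f(\mathcal S)*\mathcal V^H$ with $\hat f(\mathcal S)=\mathrm{bcirc}^{-1}\big((F_p\otimes I_m)\mathrm{diag}(\tilde f(\Sigma_1),\dots,\tilde f(\Sigma_p))(F_p^H\otimes I_n)\big)$ and $\tilde f(\Sigma_i)=f(\sqrt{\Sigma_i\Sigma_i^H})(\sqrt{\Sigma_i\Sigma_i^H})^\dagger\Sigma_i$, i.e. $\tilde f(\Sigma_i)$ is diagonal, with $f(\sigma)$ in place of each diagonal entry $\sigma>0$ and $0$ in place of each diagonal entry $0$. *)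

theory Defs
  imports Complex_Main
    "Jordan_Normal_Form.DL_Rank"
    "Jordan_Normal_Form.Schur_Decomposition"
begin

section \<open>Third-order tensors and the T-product\<close>

text \<open>A tensor of size $m \times n \times p$ is the list of its $p$ frontal slices.  Indices start
  at $0$: the slice written $A^{(k+1)}$ on paper is \<open>A ! k\<close>.\<close>

type_synonym tensor = "complex mat list"

definition tensors :: "nat \<Rightarrow> nat \<Rightarrow> nat \<Rightarrow> tensor set" where
  "tensors m n p = {A. length A = p \<and> set A \<subseteq> carrier_mat m n}"

text \<open>The sizes are read off the first slice; this is meaningful for tensors with at least one
  slice.\<close>

definition nrows :: "tensor \<Rightarrow> nat" where
  "nrows A = dim_row (hd A)"

definition ncols :: "tensor \<Rightarrow> nat" where
  "ncols A = dim_col (hd A)"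

definition unfold_tensor :: "tensor \<Rightarrow> complex mat" where
  "unfold_tensor A = mat (length A * nrows A) (ncols A)
     (\<lambda>(i, j). (A ! (i div nrows A)) $$ (i mod nrows A, j))"

text \<open>\<open>fold_tensor p\<close> cuts a matrix with $mp$ rows into $p$ slices with $m$ rows each.\<close>

definition fold_tensor :: "nat \<Rightarrow> complex mat \<Rightarrow> tensor" where
  "fold_tensor p M = (let m = dim_row M div p in
     map (\<lambda>k. mat m (dim_col M) (\<lambda>(i, j). M $$ (k * m + i, j))) [0..<p])"

definition bcirc :: "tensor \<Rightarrow> complex mat" where
  "bcirc A = mat (nrows A * length A) (ncols A * length A)
     (\<lambda>(i, j). (A ! nat ((int (i div nrows A) - int (j div ncols A)) mod int (length A)))
        $$ (i mod nrows A, j mod ncols A))"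

text \<open>The inverse of \<^const>\<open>bcirc\<close> on its image, for a given tensor size
  (see \<open>bcirc_inv_bcirc\<close> below).\<close>

definition bcirc_inv :: "nat \<Rightarrow> nat \<Rightarrow> nat \<Rightarrow> complex mat \<Rightarrow> tensor" where
  "bcirc_inv m n p = the_inv_into (tensors m n p) bcirc"

definition tprod :: "tensor \<Rightarrow> tensor \<Rightarrow> tensor" (infixl \<open>*\<^sub>T\<close> 70) where
  "A *\<^sub>T B = fold_tensor (length A) (bcirc A * unfold_tensor B)"

definition tadjoint :: "tensor \<Rightarrow> tensor" where
  "tadjoint A = (case map mat_adjoint A of [] \<Rightarrow> [] | X # Xs \<Rightarrow> X # rev Xs)"

definition identity_tensor :: "nat \<Rightarrow> nat \<Rightarrow> tensor" where
  "identity_tensor n p = 1\<^sub>m n # replicate (p - 1) (0\<^sub>m n n)"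

definition unitary_tensor :: "nat \<Rightarrow> nat \<Rightarrow> tensor \<Rightarrow> bool" where
  "unitary_tensor n p Q \<longleftrightarrow> Q \<in> tensors n n p \<and>
     tadjoint Q *\<^sub>T Q = identity_tensor n p \<and> Q *\<^sub>T tadjoint Q = identity_tensor n p"

definition F_diagonal :: "tensor \<Rightarrow> bool" where
  "F_diagonal S \<longleftrightarrow> (\<forall>X \<in> set S. diagonal_mat X)"

section \<open>Generalized matrix functions\<close>

definition compact_SVD :: "complex mat \<Rightarrow> complex mat \<Rightarrow> real list \<Rightarrow> complex mat \<Rightarrow> bool" where
  "compact_SVD M U \<sigma> V \<longleftrightarrow> (let r = vec_space.rank (dim_row M) M in
     U \<in> carrier_mat (dim_row M) r \<and> V \<in> carrier_mat (dim_col M) r \<and> length \<sigma> = r \<and>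
     mat_adjoint U * U = 1\<^sub>m r \<and> mat_adjoint V * V = 1\<^sub>m r \<and>
     sorted_wrt (\<ge>) \<sigma> \<and> (\<forall>s \<in> set \<sigma>. s > 0) \<and>
     M = U * mat_diag r (\<lambda>i. complex_of_real (\<sigma> ! i)) * mat_adjoint V)"

text \<open>The value does not depend on the compact SVD that is used; the definite description
  picks out this common value.\<close>

definition gen_mat_fun :: "(complex \<Rightarrow> complex) \<Rightarrow> complex mat \<Rightarrow> complex mat" where
  "gen_mat_fun f M = (THE N. \<exists>U \<sigma> V. compact_SVD M U \<sigma> V \<and>
     N = U * mat_diag (length \<sigma>) (\<lambda>i. f (complex_of_real (\<sigma> ! i))) * mat_adjoint V)"

section \<open>Generalized tensor functions\<close>

definition kronecker :: "complex mat \<Rightarrow> complex mat \<Rightarrow> complex mat" (infixl \<open>\<otimes>\<^sub>K\<close> 70) where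
  "A \<otimes>\<^sub>K B = mat (dim_row A * dim_row B) (dim_col A * dim_col B)
     (\<lambda>(i, j). A $$ (i div dim_row B, j div dim_col B) * B $$ (i mod dim_row B, j mod dim_col B))"

definition dft_mat :: "nat \<Rightarrow> complex mat" where
  "dft_mat p = mat p p
     (\<lambda>(j, k). exp (- 2 * of_real pi * \<i> / of_nat p) ^ (j * k) / of_real (sqrt (real p)))"

text \<open>$(F_p \otimes I_m)\,\mathrm{diag}(D_1,\dots,D_p)\,(F_p^H \otimes I_n)$ for $m \times n$
  blocks $D_1,\dots,D_p$.\<close>

definition fourier_block_diag :: "nat \<Rightarrow> nat \<Rightarrow> nat \<Rightarrow> complex mat list \<Rightarrow> complex mat" where
  "fourier_block_diag m n p Ds =
     (dft_mat p \<otimes>\<^sub>K 1\<^sub>m m) * diag_block_mat Ds * (mat_adjoint (dft_mat p) \<otimes>\<^sub>K 1\<^sub>m n)"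

definition nonneg_diagonal :: "nat \<Rightarrow> nat \<Rightarrow> real mat \<Rightarrow> bool" where
  "nonneg_diagonal m n \<Sigma> \<longleftrightarrow> \<Sigma> \<in> carrier_mat m n \<and> diagonal_mat \<Sigma> \<and>
     (\<forall>i < min m n. \<Sigma> $$ (i, i) \<ge> 0)"

definition T_SVD :: "tensor \<Rightarrow> tensor \<Rightarrow> tensor \<Rightarrow> tensor \<Rightarrow> real mat list \<Rightarrow> bool" where
  "T_SVD A U S V \<Sigma>s \<longleftrightarrow> (let m = nrows A; n = ncols A; p = length A in
     unitary_tensor m p U \<and> unitary_tensor n p V \<and>
     S \<in> tensors m n p \<and> F_diagonal S \<and>
     length \<Sigma>s = p \<and> (\<forall>\<Sigma> \<in> set \<Sigma>s. nonneg_diagonal m n \<Sigma>) \<and>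
     bcirc S = fourier_block_diag m n p (map (map_mat complex_of_real) \<Sigma>s) \<and>
     A = U *\<^sub>T S *\<^sub>T tadjoint V)"

text \<open>For a nonnegative diagonal \<open>\<Sigma>\<close> this is
  $f(\sqrt{\Sigma\Sigma^H})\,(\sqrt{\Sigma\Sigma^H})^\dagger\,\Sigma$: each diagonal entry
  $\sigma > 0$ becomes $f(\sigma)$, and every zero entry, on or off the diagonal, stays $0$
  whatever $f(0)$ is.\<close>

definition f_tilde :: "(complex \<Rightarrow> complex) \<Rightarrow> real mat \<Rightarrow> complex mat" where
  "f_tilde f \<Sigma> = map_mat (\<lambda>s. if s > 0 then f (complex_of_real s) else 0) \<Sigma>"

text \<open>$\hat f(\mathcal S)$, given through the blocks $\Sigma_1,\dots,\Sigma_p$ of $\mathcal S$.\<close>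

definition f_hat :: "(complex \<Rightarrow> complex) \<Rightarrow> nat \<Rightarrow> nat \<Rightarrow> real mat list \<Rightarrow> tensor" where
  "f_hat f m n \<Sigma>s =
     bcirc_inv m n (length \<Sigma>s) (fourier_block_diag m n (length \<Sigma>s) (map (f_tilde f) \<Sigma>s))"

text \<open>As for matrices, the value does not depend on the T-SVD that is used.\<close>

definition gen_tensor_fun :: "(complex \<Rightarrow> complex) \<Rightarrow> tensor \<Rightarrow> tensor" where
  "gen_tensor_fun f A = (THE B. \<exists>U S V \<Sigma>s. T_SVD A U S V \<Sigma>s \<and>
     B = U *\<^sub>T f_hat f (nrows A) (ncols A) \<Sigma>s *\<^sub>T tadjoint V)"

section \<open>\<open>fold_tensor\<close> and \<open>bcirc_inv\<close> are inverse operations\<close>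

lemma tensors_dims:
  assumes "A \<in> tensors m n p" "p > 0"
  shows "length A = p" "nrows A = m" "ncols A = n" "\<And>k. k < p \<Longrightarrow> A ! k \<in> carrier_mat m n"
proof -
  show len: "length A = p" using assms by (simp add: tensors_def)
  show nth: "A ! k \<in> carrier_mat m n" if "k < p" for k
    using assms that len by (auto simp: tensors_def)
  have "hd A = A ! 0" using assms len by (intro hd_conv_nth) auto
  then show "nrows A = m" "ncols A = n" using nth[of 0] assms by (auto simp: nrows_def ncols_def)
qed

lemma block_index_less:
  assumes "k < p" "i < (m :: nat)"
  shows "k * m + i < p * m"
proof -
  have "k * m + i < Suc k * m" using assms by simp
  also have "\<dots> \<le> p * m" using assms by (intro mult_le_mono1) simp
  finally show ?thesis .
qed

lemma fold_unfold_tensor: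
  assumes "A \<in> tensors m n p" "p > 0"
  shows "fold_tensor p (unfold_tensor A) = A"
proof (rule nth_equalityI)
  note d = tensors_dims[OF assms]
  show "length (fold_tensor p (unfold_tensor A)) = length A"
    by (simp add: fold_tensor_def d Let_def)
  fix k assume "k < length (fold_tensor p (unfold_tensor A))"
  then have k: "k < p" by (simp add: fold_tensor_def Let_def)
  show "fold_tensor p (unfold_tensor A) ! k = A ! k"
    using carrier_matD[OF d(4)[OF k]] k assms(2) block_index_less[OF k]
    by (intro eq_matI) (auto simp: fold_tensor_def unfold_tensor_def d(1-3) Let_def)
qed

lemma bcirc_inj:
  assumes "p > 0"
  shows "inj_on bcirc (tensors m n p)"
proof (rule inj_onI)
  fix A B assume A: "A \<in> tensors m n p" and B: "B \<in> tensors m n p" and eq: "bcirc A = bcirc B"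
  note a = tensors_dims[OF A assms] and b = tensors_dims[OF B assms]
  have entry: "bcirc C $$ (k * m + i, j) = C ! k $$ (i, j)"
    if C: "C \<in> tensors m n p" and k: "k < p" and i: "i < m" and j: "j < n" for C k i j
  proof -
    note c = tensors_dims[OF C assms]
    have "k * m + i < m * p" using block_index_less[OF k i] by (simp add: mult.commute)
    moreover have "j < n * p"
      using block_index_less[OF assms j] by (simp add: mult.commute)
    ultimately show ?thesis using i j k by (simp add: bcirc_def c(1-3))
  qed
  show "A = B"
  proof (rule nth_equalityI)
    show "length A = length B" by (simp add: a b)
    fix k assume "k < length A"
    then have k: "k < p" by (simp add: a)
    show "A ! k = B ! k"
      using carrier_matD[OF a(4)[OF k]] carrier_matD[OF b(4)[OF k]] entry[OF A k] entry[OF B k] eq by (intro eq_matI) auto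
  qed
qed

lemma bcirc_inv_bcirc:
  assumes "A \<in> tensors m n p" "p > 0"
  shows "bcirc_inv m n p (bcirc A) = A"
  unfolding bcirc_inv_def using the_inv_into_f_f[OF bcirc_inj] assms by blast

end

theory Submission
  imports Defs
begin

text \<open>Let $q$ be a polynomial with $q(\sigma^2) = f(\sigma)/\sigma$ for all singular values
  $\sigma > 0$ that occur.  For every decomposition $M = X D Y^H$ with isometries $X$, $Y$ and a
  nonnegative $D$ that has at most one nonzero entry in each row and column, applying $f$ to the
  positive entries of $D$ gives $X \tilde f(D) Y^H = M\,q(M^H M)$, so the result does not depend on
  the decomposition.  A compact SVD of \<open>bcirc A\<close> is such a decomposition.  Since \<open>bcirc\<close> turns
  T-products into products and $(F_p \otimes I)$ is unitary, a T-SVD of \<open>A\<close> gives another one, with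
  $X = \mathrm{bcirc}(\mathcal U)(F_p \otimes I_m)$, $D = \mathrm{diag}(\Sigma_1,\dots,\Sigma_p)$ and
  $Y = \mathrm{bcirc}(\mathcal V)(F_p \otimes I_n)$.  Both decompositions exist; the T-SVD comes from
  the SVDs of the Fourier blocks of \<open>A\<close>.\<close>

section \<open>Products and adjoints\<close>

text \<open>Both generalized functions are definite descriptions, so neither can be evaluated before
  existence and uniqueness of its value are known. The obstacle is that the two decompositions to be
  compared differ in shape: a compact SVD has sorted positive singular values and as many columns as
  the rank, whereas the Fourier blocks bring unsorted values, zeros and, when m and n differ, a
  block diagonal matrix whose nonzero entries leave the main diagonal. Matching them by
  permutations, and by the unitary freedom within repeated singular values, is avoided by
  characterising the value through a formula in M alone. The monomial shape of D is just what makes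
  D^H D diagonal, as that formula requires. The value f(0) never enters, because the polynomial
  comes with a factor D that vanishes there. For tensors, uniqueness is inherited: the values
  obtained from all T-SVDs have the same image under the injective \<open>bcirc\<close>.\<close>

lemma mult_mat_entry:
  assumes "A \<in> carrier_mat m n" "B \<in> carrier_mat n s" "i < m" "j < s"
  shows "(A * B) $$ (i, j) = (\<Sum>k<n. A $$ (i, k) * B $$ (k, j))"
  using assms by (auto simp: scalar_prod_def atLeast0LessThan intro!: sum.cong)

lemma mat_adjoint_dim [simp]:
  "dim_row (mat_adjoint A) = dim_col A" "dim_col (mat_adjoint A) = dim_row A"
  by (simp_all add: mat_adjoint_def)

lemma mat_adjoint_carrier [simp]: "A \<in> carrier_mat m n \<Longrightarrow> mat_adjoint A \<in> carrier_mat n m"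
  by (intro carrier_matI) simp_all

lemma mat_adjoint_entry [simp]:
  "i < dim_col A \<Longrightarrow> j < dim_row A \<Longrightarrow> mat_adjoint A $$ (i, j) = cnj (A $$ (j, i))"
  by (simp add: mat_adjoint_def mat_of_rows_def)

lemma mat_adjoint_adjoint [simp]: "mat_adjoint (mat_adjoint A) = (A :: complex mat)"
  by (rule eq_matI) auto

lemma mat_adjoint_mult:
  assumes "A \<in> carrier_mat m n" "B \<in> carrier_mat n s"
  shows "mat_adjoint (A * B) = mat_adjoint B * mat_adjoint (A :: complex mat)"
  using assms
  by (intro eq_matI) (auto simp: scalar_prod_def intro!: sum.cong)

lemma sum_blocks:
  fixes g :: "nat \<Rightarrow> 'a :: comm_monoid_add"
  shows "(\<Sum>l<p * m. g l) = (\<Sum>k<p. \<Sum>t<m. g (k * m + t))"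
proof -
  have "(\<Sum>t<m. g (k * m + t)) = sum g {k * m..<k * m + m}" for k
    using sum.shift_bounds_nat_ivl[of g 0 "k * m" m] by (simp add: atLeast0LessThan add.commute)
  then show ?thesis by (simp add: sum.nat_group)
qed

section \<open>Independence of the singular value decomposition\<close>

text \<open>Newton interpolation: a multiple of the product of (x - s) over the old nodes corrects
  the value at a new node without disturbing the old ones.\<close>

lemma interpolating_poly:
  fixes g :: "complex \<Rightarrow> complex"
  assumes "finite S"
  shows "\<exists>q. \<forall>x\<in>S. poly q x = g x"
  using assms
proof (induction S)
  case (insert a S)
  then obtain q where q: "\<forall>x\<in>S. poly q x = g x" by blast
  define w where "w = (\<Prod>s\<in>S. [:- s, 1:])"
  have "poly w a \<noteq> 0" "\<forall>x\<in>S. poly w x = 0"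
    using insert.hyps by (auto simp: w_def poly_prod)
  then have "\<forall>x\<in>insert a S. poly (q + smult ((g a - poly q a) / poly w a) w) x = g x"
    using q by auto
  then show ?case by blast
qed simp

text \<open>A nonnegative matrix of this shape is, up to permutations of rows and columns, a
  rectangular diagonal matrix.  Both the square matrix of a compact SVD and the block diagonal
  matrix of the blocks of a T-SVD have this shape.\<close>

definition nonneg_monomial :: "real mat \<Rightarrow> bool" where
  "nonneg_monomial D \<longleftrightarrow>
     (\<forall>i < dim_row D. \<forall>j < dim_col D. D $$ (i, j) \<ge> 0) \<and>
     (\<forall>i < dim_row D. \<forall>j < dim_col D. \<forall>k < dim_col D.
        D $$ (i, j) \<noteq> 0 \<longrightarrow> D $$ (i, k) \<noteq> 0 \<longrightarrow> j = k) \<and>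
     (\<forall>i < dim_row D. \<forall>k < dim_row D. \<forall>j < dim_col D.
        D $$ (i, j) \<noteq> 0 \<longrightarrow> D $$ (k, j) \<noteq> 0 \<longrightarrow> i = k)"

text \<open>The factors need orthonormal columns only, and \<open>D\<close> may be rectangular,
  unsorted and contain zeros, so compact and blockwise decompositions fit without matching rank,
  order or size.\<close>

definition monomial_SVD :: "complex mat \<Rightarrow> complex mat \<Rightarrow> real mat \<Rightarrow> complex mat \<Rightarrow> bool" where
  "monomial_SVD M X D Y \<longleftrightarrow>
     X \<in> carrier_mat (dim_row M) (dim_row D) \<and> Y \<in> carrier_mat (dim_col M) (dim_col D) \<and>
     mat_adjoint X * X = 1\<^sub>m (dim_row D) \<and> mat_adjoint Y * Y = 1\<^sub>m (dim_col D) \<and>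
     nonneg_monomial D \<and> M = X * map_mat complex_of_real D * mat_adjoint Y"

text \<open>Distinct columns of \<open>D\<close> have disjoint supports, so D^H D is diagonal and
  holds the square of the single nonzero entry of each column. Since \<open>g 0 = 0\<close>,
  applying \<open>g\<close> creates no new nonzero positions, and each entry is scaled by its own
  square.\<close>

lemma nonneg_monomial_gram:
  assumes D: "nonneg_monomial D" and g: "g 0 = 0"
  shows "map_mat g D * (mat_adjoint (map_mat complex_of_real D) * map_mat complex_of_real D)
       = map_mat (\<lambda>s. complex_of_real s ^ 2 * g s) D"
    (is "?G * (mat_adjoint ?D * ?D) = ?R")
proof -
  define r c where "r = dim_row D" and "c = dim_col D"
  have dims: "?G \<in> carrier_mat r c" "?D \<in> carrier_mat r c" "mat_adjoint ?D \<in> carrier_mat c r"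
    "mat_adjoint ?D * ?D \<in> carrier_mat c c"
    by (auto simp: r_def c_def)
  have gram: "(mat_adjoint ?D * ?D) $$ (k, j) =
      (if k = j then \<Sum>l<r. complex_of_real (D $$ (l, j)) ^ 2 else 0)" if "k < c" "j < c" for k j
  proof -
    have *: "D $$ (l, k) = 0 \<or> D $$ (l, j) = 0" if "k \<noteq> j" "l < r" for l
      using D that \<open>k < c\<close> \<open>j < c\<close> unfolding nonneg_monomial_def r_def c_def by blast
    have "(mat_adjoint ?D * ?D) $$ (k, j) =
        (\<Sum>l<r. complex_of_real (D $$ (l, k)) * complex_of_real (D $$ (l, j)))"
      using that by (subst mult_mat_entry[OF dims(3,2)]) (auto simp: r_def c_def)
    then show ?thesis using * by (auto simp: power2_eq_square intro!: sum.neutral)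
  qed
  show ?thesis
  proof (rule eq_matI)
    fix i j assume "i < dim_row ?R" "j < dim_col ?R"
    then have i: "i < r" and j: "j < c" by (auto simp: r_def c_def)
    have "(?G * (mat_adjoint ?D * ?D)) $$ (i, j) =
        (\<Sum>k<c. g (D $$ (i, k)) * (if k = j then \<Sum>l<r. complex_of_real (D $$ (l, j)) ^ 2 else 0))"
      unfolding mult_mat_entry[OF dims(1,4) i j]
      using i j by (intro sum.cong) (simp_all add: gram r_def c_def del: index_mult_mat)
    also have "\<dots> = g (D $$ (i, j)) * (\<Sum>l<r. complex_of_real (D $$ (l, j)) ^ 2)"
      using j by (simp add: if_distrib[of "\<lambda>x. _ * x"] sum.delta cong: if_cong)
    also have "\<dots> = complex_of_real (D $$ (i, j)) ^ 2 * g (D $$ (i, j))"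
    proof (cases "D $$ (i, j) = 0")
      case False
      then have "D $$ (l, j) = 0" if "l < r" "l \<noteq> i" for l
        using D that i j unfolding nonneg_monomial_def r_def c_def by blast
      then have "(\<Sum>l<r. complex_of_real (D $$ (l, j)) ^ 2) =
          (\<Sum>l<r. if l = i then complex_of_real (D $$ (i, j)) ^ 2 else 0)"
        by (intro sum.cong) auto
      then show ?thesis using i by (simp add: sum.delta)
    qed (simp add: g)
    finally show "(?G * (mat_adjoint ?D * ?D)) $$ (i, j) = ?R $$ (i, j)"
      using i j by (simp add: r_def c_def)
  qed auto
qed

text \<open>With $D$ as above, $X\,(D\,q(D^HD))\,Y^H = M\,q(M^HM)$, which no longer mentions
  $X$, $D$ and $Y$.  The recursion for \<open>pCons a q\<close> expresses this without polynomials in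
  matrices.\<close>

lemma monomial_SVD_poly_pCons:
  assumes svd: "monomial_SVD M X D Y"
  defines "P \<equiv> \<lambda>q. X * map_mat (\<lambda>s. complex_of_real s * poly q (complex_of_real s ^ 2)) D
             * mat_adjoint Y"
  shows "P (pCons a q) = a \<cdot>\<^sub>m M + P q * (mat_adjoint M * M)"
proof -
  define r c where "r = dim_row D" and "c = dim_col D"
  define E where "E q = map_mat (\<lambda>s. complex_of_real s * poly q (complex_of_real s ^ 2)) D" for q
  define C where "C = map_mat complex_of_real D"
  define m n where "m = dim_row M" and "n = dim_col M"
  have X: "X \<in> carrier_mat m r" and Y: "Y \<in> carrier_mat n c"
    and XX: "mat_adjoint X * X = 1\<^sub>m r" and YY: "mat_adjoint Y * Y = 1\<^sub>m c"
    and mono: "nonneg_monomial D" and M: "M = X * C * mat_adjoint Y"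
    using svd by (auto simp: monomial_SVD_def r_def c_def C_def m_def n_def)
  have C: "C \<in> carrier_mat r c" and E: "E q \<in> carrier_mat r c" for q
    by (auto simp: C_def E_def r_def c_def)
  note cX = mat_adjoint_carrier[OF X] and cY = mat_adjoint_carrier[OF Y]
    and cC = mat_adjoint_carrier[OF C]
  have Z: "C * mat_adjoint Y \<in> carrier_mat r n" using C cY by auto
  have EC: "E q * (mat_adjoint C * C) = map_mat (\<lambda>s. complex_of_real s ^ 2 *
      (complex_of_real s * poly q (complex_of_real s ^ 2))) D"
    unfolding E_def C_def by (rule nonneg_monomial_gram[OF mono]) simp
  \<comment> \<open>At s^2 the polynomial \<open>pCons a q\<close> takes the value a + s^2 q(s^2);
    after multiplication by s, the second summand is the entry given by \<open>EC\<close>.\<close>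
  have E_pCons: "E (pCons a q) = a \<cdot>\<^sub>m C + E q * (mat_adjoint C * C)"
    unfolding EC unfolding C_def E_def by (intro eq_matI) (auto simp: algebra_simps)
  have "mat_adjoint M = Y * (mat_adjoint C * mat_adjoint X)"
    unfolding M by (simp add: mat_adjoint_mult[OF mult_carrier_mat[OF X C] cY]
      mat_adjoint_mult[OF X C])
  then have "mat_adjoint M * M = Y * (mat_adjoint C * mat_adjoint X) * (X * (C * mat_adjoint Y))"
    unfolding M by (simp add: assoc_mult_mat[OF X C cY])
  also have "\<dots> = Y * (mat_adjoint C * (mat_adjoint X * (X * (C * mat_adjoint Y))))"
    by (simp add: assoc_mult_mat[OF Y mult_carrier_mat[OF cC cX] mult_carrier_mat[OF X Z]]
      assoc_mult_mat[OF cC cX mult_carrier_mat[OF X Z]])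
  \<comment> \<open>The isometry \<open>X\<close> cancels here and \<open>Y\<close> cancels in the
    next chain, so only products of diagonal-like matrices remain between the outer factors.\<close>
  also have "mat_adjoint X * (X * (C * mat_adjoint Y)) = C * mat_adjoint Y"
    by (simp add: assoc_mult_mat[OF cX X Z, symmetric] XX left_mult_one_mat[OF Z])
  finally have MM: "mat_adjoint M * M = Y * (mat_adjoint C * (C * mat_adjoint Y))" .
  have CCY: "mat_adjoint C * (C * mat_adjoint Y) \<in> carrier_mat c n"
    using mult_carrier_mat[OF cC Z] .
  have "X * E q * mat_adjoint Y * (mat_adjoint M * M)
      = X * E q * (mat_adjoint Y * (Y * (mat_adjoint C * (C * mat_adjoint Y))))"
    unfolding MM using assoc_mult_mat[OF mult_carrier_mat[OF X E] cY mult_carrier_mat[OF Y CCY]] .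
  also have "mat_adjoint Y * (Y * (mat_adjoint C * (C * mat_adjoint Y)))
      = mat_adjoint C * (C * mat_adjoint Y)"
    by (simp add: assoc_mult_mat[OF cY Y CCY, symmetric] YY left_mult_one_mat[OF CCY])
  also have "X * E q * (mat_adjoint C * (C * mat_adjoint Y))
      = X * (E q * (mat_adjoint C * C)) * mat_adjoint Y"
    unfolding assoc_mult_mat[OF X E CCY] unfolding assoc_mult_mat[OF cC C cY, symmetric]
    unfolding assoc_mult_mat[OF E mult_carrier_mat[OF cC C] cY, symmetric]
      assoc_mult_mat[OF X mult_carrier_mat[OF E mult_carrier_mat[OF cC C]] cY, symmetric] ..
  finally have main: "X * E q * mat_adjoint Y * (mat_adjoint M * M)
      = X * (E q * (mat_adjoint C * C)) * mat_adjoint Y" .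
  have "X * E (pCons a q) * mat_adjoint Y
      = a \<cdot>\<^sub>m M + X * (E q * (mat_adjoint C * C)) * mat_adjoint Y"
  proof -
    have F: "E q * (mat_adjoint C * C) \<in> carrier_mat r c"
      using mult_carrier_mat[OF E mult_carrier_mat[OF cC C]] .
    have "X * (a \<cdot>\<^sub>m C + E q * (mat_adjoint C * C))
        = a \<cdot>\<^sub>m (X * C) + X * (E q * (mat_adjoint C * C))"
      using mult_add_distrib_mat[OF X smult_carrier_mat[OF C] F] mult_smult_distrib[OF X C] by simp
    then show ?thesis
      unfolding E_pCons M
      using add_mult_distrib_mat[OF smult_carrier_mat[OF mult_carrier_mat[OF X C]]
          mult_carrier_mat[OF X F] cY] mult_smult_assoc_mat[OF mult_carrier_mat[OF X C] cY]
      by simp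
  qed
  then show ?thesis using main by (simp add: P_def E_def)
qed

text \<open>The recursion step refers to the decomposition only through the value at the shorter
  polynomial, so equality propagates from the zero polynomial, where both sides vanish.\<close>

lemma monomial_SVD_poly_unique:
  assumes "monomial_SVD M X D Y" "monomial_SVD M X' D' Y'"
  shows "X * map_mat (\<lambda>s. complex_of_real s * poly q (complex_of_real s ^ 2)) D * mat_adjoint Y
       = X' * map_mat (\<lambda>s. complex_of_real s * poly q (complex_of_real s ^ 2)) D' * mat_adjoint Y'"
proof (induction q)
  case 0
  have *: "U * map_mat (\<lambda>s. complex_of_real s * poly 0 (complex_of_real s ^ 2)) E * mat_adjoint W
      = 0\<^sub>m (dim_row M) (dim_col M)" if "monomial_SVD M U E W" for U E W
  proof -
    have U: "U \<in> carrier_mat (dim_row M) (dim_row E)" and W: "W \<in> carrier_mat (dim_col M) (dim_col E)"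
      using that by (auto simp: monomial_SVD_def)
    have z: "map_mat (\<lambda>s. complex_of_real s * poly 0 (complex_of_real s ^ 2)) E
        = 0\<^sub>m (dim_row E) (dim_col E)"
      by (rule eq_matI) auto
    show ?thesis
      unfolding z using right_mult_zero_mat[OF U] left_mult_zero_mat[OF mat_adjoint_carrier[OF W]]
      by simp
  qed
  show ?case using *[OF assms(1)] *[OF assms(2)] by simp
next
  case (pCons a q)
  show ?case unfolding monomial_SVD_poly_pCons[OF assms(1)] monomial_SVD_poly_pCons[OF assms(2)]
    pCons.IH ..
qed

lemma monomial_SVD_unique:
  assumes "monomial_SVD M X D Y" "monomial_SVD M X' D' Y'"
  shows "X * f_tilde f D * mat_adjoint Y = X' * f_tilde f D' * mat_adjoint Y'"
proof -
  \<comment> \<open>The entries of both decompositions are collected, so that one polynomial serves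
    both.\<close>
  define S where "S = {D $$ (i, j) | i j. i < dim_row D \<and> j < dim_col D}
    \<union> {D' $$ (i, j) | i j. i < dim_row D' \<and> j < dim_col D'}"
  have "finite S" unfolding S_def
    by (auto intro!: finite_image_set2)
  \<comment> \<open>The nodes are squares; \<open>sqrt (Re x)\<close> recovers s from x = s^2 for s
    \<ge> 0. At s = 0 the prescribed quotient is 0 by convention, and the factor s in front of q
    hides this value.\<close>
  then obtain q where "\<forall>x\<in>(\<lambda>s. complex_of_real s ^ 2) ` S.
      poly q x = f (complex_of_real (sqrt (Re x))) / complex_of_real (sqrt (Re x))"
    using interpolating_poly[of "(\<lambda>s. complex_of_real s ^ 2) ` S"
       "\<lambda>x. f (complex_of_real (sqrt (Re x))) / complex_of_real (sqrt (Re x))"] by auto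
  then have q: "poly q (complex_of_real s ^ 2) = f (complex_of_real s) / complex_of_real s"
    if "s \<in> S" "s \<ge> 0" for s
    using that by (auto simp flip: of_real_power)
  have tilde: "f_tilde f E = map_mat (\<lambda>s. complex_of_real s * poly q (complex_of_real s ^ 2)) E"
    if "nonneg_monomial E" "\<And>i j. i < dim_row E \<Longrightarrow> j < dim_col E \<Longrightarrow> E $$ (i, j) \<in> S" for E
    unfolding f_tilde_def
  proof (rule eq_matI)
    fix i j
    assume "i < dim_row (map_mat (\<lambda>s. complex_of_real s * poly q (complex_of_real s ^ 2)) E)"
      and "j < dim_col (map_mat (\<lambda>s. complex_of_real s * poly q (complex_of_real s ^ 2)) E)"
    then have ij: "i < dim_row E" "j < dim_col E" by auto
    then have "E $$ (i, j) \<ge> 0" using that(1) by (auto simp: nonneg_monomial_def)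
    then show "map_mat (\<lambda>s. if 0 < s then f (complex_of_real s) else 0) E $$ (i, j) =
        map_mat (\<lambda>s. complex_of_real s * poly q (complex_of_real s ^ 2)) E $$ (i, j)"
      using ij q[OF that(2)[OF ij]] by auto
  qed auto
  have "f_tilde f D = map_mat (\<lambda>s. complex_of_real s * poly q (complex_of_real s ^ 2)) D"
    "f_tilde f D' = map_mat (\<lambda>s. complex_of_real s * poly q (complex_of_real s ^ 2)) D'"
    by (rule tilde; use assms in \<open>auto simp: monomial_SVD_def S_def\<close>)+
  then show ?thesis using monomial_SVD_poly_unique[OF assms] by simp
qed

section \<open>Block diagonal and Kronecker product matrices\<close>

text \<open>When all blocks have the same size, div gives the block number and mod the offset inside
  the block. This closed form replaces the recursion of \<open>diag_block_mat\<close> in all later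
  entrywise arguments.\<close>

lemma diag_block_mat_equal_blocks:
  assumes "\<forall>D\<in>set Ds. D \<in> carrier_mat m n"
  shows "diag_block_mat Ds \<in> carrier_mat (length Ds * m) (length Ds * n)"
    and "i < length Ds * m \<Longrightarrow> j < length Ds * n \<Longrightarrow> diag_block_mat Ds $$ (i, j) =
      (if i div m = j div n then Ds ! (i div m) $$ (i mod m, j mod n) else 0)"
proof -
  have "diag_block_mat Ds \<in> carrier_mat (length Ds * m) (length Ds * n) \<and>
    (\<forall>i j. i < length Ds * m \<longrightarrow> j < length Ds * n \<longrightarrow> diag_block_mat Ds $$ (i, j) =
      (if i div m = j div n then Ds ! (i div m) $$ (i mod m, j mod n) else 0))"
    using assms
  proof (induction Ds)
    case (Cons D Ds)
    have D: "D \<in> carrier_mat m n" and IH: "diag_block_mat Ds \<in> carrier_mat (length Ds * m) (length Ds * n)"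
      "\<And>i j. i < length Ds * m \<Longrightarrow> j < length Ds * n \<Longrightarrow> diag_block_mat Ds $$ (i, j) =
      (if i div m = j div n then Ds ! (i div m) $$ (i mod m, j mod n) else 0)"
      using Cons by auto
    have entry: "diag_block_mat (D # Ds) $$ (i, j) =
      (if i div m = j div n then (D # Ds) ! (i div m) $$ (i mod m, j mod n) else 0)"
      if i: "i < length (D # Ds) * m" and j: "j < length (D # Ds) * n" for i j
    proof -
      have m: "m > 0" and n: "n > 0" using i j by (auto intro: Nat.gr0I)
      \<comment> \<open>Removing the first block lowers the block number by one and keeps the
        offset.\<close>
      have i': "i div m = Suc ((i - m) div m)" "i mod m = (i - m) mod m" "i - m < length Ds * m"
        if "\<not> i < m" using that m i by (auto simp: le_div_geq le_mod_geq)
      have j': "j div n = Suc ((j - n) div n)" "j mod n = (j - n) mod n" "j - n < length Ds * n"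
        if "\<not> j < n" using that n j by (auto simp: le_div_geq le_mod_geq)
      have "diag_block_mat (D # Ds) $$ (i, j) =
         (if i < m then if j < n then D $$ (i, j) else 0
          else if j < n then 0 else diag_block_mat Ds $$ (i - m, j - n))"
        using i j D IH(1) by (auto simp: Let_def)
      also have "\<dots> = (if i div m = j div n then (D # Ds) ! (i div m) $$ (i mod m, j mod n) else 0)"
        using i' j' IH(2)[of "i - m" "j - n"] by (cases "i < m"; cases "j < n") auto
      finally show ?thesis .
    qed
    then show ?case using D IH(1) by (auto simp: Let_def)
  qed simp
  then show "diag_block_mat Ds \<in> carrier_mat (length Ds * m) (length Ds * n)"
    and "i < length Ds * m \<Longrightarrow> j < length Ds * n \<Longrightarrow> diag_block_mat Ds $$ (i, j) =
      (if i div m = j div n then Ds ! (i div m) $$ (i mod m, j mod n) else 0)" by blast+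
qed

lemma block_index_bounds:
  assumes "i < p * (m :: nat)"
  shows "i div m < p" "i mod m < m" "m > 0"
proof -
  show m: "m > 0" using assms by (auto intro: Nat.gr0I)
  then show "i div m < p" "i mod m < m" using assms by (auto simp: less_mult_imp_div_less)
qed

lemma block_index_div_mod:
  fixes p k t m :: nat
  assumes "k < p" "t < m"
  shows "k * m + t < p * m" "(k * m + t) div m = k" "(k * m + t) mod m = t"
  using block_index_less[OF assms] assms by auto

lemma diag_block_mat_mult:
  assumes Ds: "\<forall>D\<in>set Ds. D \<in> carrier_mat m n" and Es: "\<forall>E\<in>set Es. E \<in> carrier_mat n s"
    and len: "length Ds = p" "length Es = (p :: nat)"
  shows "diag_block_mat Ds * diag_block_mat Es = diag_block_mat (map2 (*) Ds (Es :: complex mat list))"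
    (is "_ = diag_block_mat ?P")
proof -
  note d = diag_block_mat_equal_blocks[OF Ds, unfolded len]
    and e = diag_block_mat_equal_blocks[OF Es, unfolded len]
  have P: "\<forall>X\<in>set ?P. X \<in> carrier_mat m s" "length ?P = p"
    using Ds Es len by (auto simp: set_zip intro!: mult_carrier_mat)
  note pr = diag_block_mat_equal_blocks[OF P(1), unfolded P(2)]
  show ?thesis
  proof (rule eq_matI)
    fix i j assume "i < dim_row (diag_block_mat ?P)" "j < dim_col (diag_block_mat ?P)"
    then have i: "i < p * m" and j: "j < p * s" using pr(1) by auto
    note bi = block_index_bounds[OF i] and bj = block_index_bounds[OF j]
    have c: "Ds ! (i div m) \<in> carrier_mat m n" "Es ! (i div m) \<in> carrier_mat n s"
      using Ds Es len bi(1) by auto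
    have "(diag_block_mat Ds * diag_block_mat Es) $$ (i, j) =
        (\<Sum>k<p. \<Sum>t<n. diag_block_mat Ds $$ (i, k * n + t) * diag_block_mat Es $$ (k * n + t, j))"
      by (simp only: mult_mat_entry[OF d(1) e(1) i j] sum_blocks)
    \<comment> \<open>Row i meets nonzero entries only in the inner block whose number is
      \<open>i div m\<close>.\<close>
    also have "\<dots> = (\<Sum>k<p. if k = i div m then \<Sum>t<n. Ds ! (i div m) $$ (i mod m, t) *
        (if i div m = j div s then Es ! (i div m) $$ (t, j mod s) else 0) else 0)"
      using i j d(2) e(2) by (intro sum.cong) (auto simp: block_index_div_mod intro!: sum.cong)
    also have "\<dots> = (\<Sum>t<n. Ds ! (i div m) $$ (i mod m, t) *
        (if i div m = j div s then Es ! (i div m) $$ (t, j mod s) else 0))"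
      using bi by (simp add: sum.delta)
    also have "\<dots> = diag_block_mat ?P $$ (i, j)"
      using pr(2)[OF i j] mult_mat_entry[OF c bi(2) bj(2)] bi(1) len
      by (cases "i div m = j div s") (simp_all del: index_mult_mat(1))
    finally show "(diag_block_mat Ds * diag_block_mat Es) $$ (i, j) = diag_block_mat ?P $$ (i, j)" .
  qed (use d(1) e(1) pr(1) in auto)
qed

lemma mat_adjoint_diag_block_mat:
  assumes Ds: "\<forall>D\<in>set Ds. D \<in> carrier_mat m n"
  shows "mat_adjoint (diag_block_mat Ds) = diag_block_mat (map mat_adjoint (Ds :: complex mat list))"
proof -
  have As: "\<forall>D\<in>set (map mat_adjoint Ds). D \<in> carrier_mat n m" using Ds by auto
  note d = diag_block_mat_equal_blocks[OF Ds] and a = diag_block_mat_equal_blocks[OF As]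
  show ?thesis
  proof (rule eq_matI)
    fix i j assume "i < dim_row (diag_block_mat (map mat_adjoint Ds))"
      "j < dim_col (diag_block_mat (map mat_adjoint Ds))"
    then have i: "i < length Ds * n" and j: "j < length Ds * m" using a(1) by auto
    have "Ds ! (i div n) \<in> carrier_mat m n" using Ds block_index_bounds(1)[OF i] by auto
    then show "mat_adjoint (diag_block_mat Ds) $$ (i, j) = diag_block_mat (map mat_adjoint Ds) $$ (i, j)"
      using i j d a(2)[of i j] block_index_bounds[OF i] block_index_bounds[OF j] by auto
  qed (use d(1) a(1) in auto)
qed

lemma diag_block_mat_one: "diag_block_mat (replicate p (1\<^sub>m n)) = (1\<^sub>m (p * n) :: complex mat)"
proof -
  have c: "\<forall>D\<in>set (replicate p (1\<^sub>m n :: complex mat)). D \<in> carrier_mat n n" by auto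
  note d = diag_block_mat_equal_blocks[OF c, unfolded length_replicate]
  show ?thesis
  proof (rule eq_matI)
    fix i j assume "i < dim_row (1\<^sub>m (p * n) :: complex mat)" "j < dim_col (1\<^sub>m (p * n) :: complex mat)"
    then have i: "i < p * n" and j: "j < p * n" by auto
    have "i = j \<longleftrightarrow> i div n = j div n \<and> i mod n = j mod n"
      by (metis div_mult_mod_eq)
    then show "diag_block_mat (replicate p (1\<^sub>m n)) $$ (i, j) = (1\<^sub>m (p * n) :: complex mat) $$ (i, j)"
      using i j d(2)[OF i j] block_index_bounds[OF i] block_index_bounds[OF j] by auto
  qed (use d(1) in auto)
qed

section \<open>Kronecker products with an identity factor\<close>

lemma kronecker_one_carrier:
  "A \<in> carrier_mat p p \<Longrightarrow> A \<otimes>\<^sub>K 1\<^sub>m m \<in> carrier_mat (p * m) (p * m)"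
  by (auto simp: kronecker_def)

lemma kronecker_one_entry:
  assumes "A \<in> carrier_mat p p" "i < p * m" "j < p * m"
  shows "(A \<otimes>\<^sub>K 1\<^sub>m m) $$ (i, j) = (if i mod m = j mod m then A $$ (i div m, j div m) else 0)"
  using assms block_index_bounds[OF assms(2)] block_index_bounds[OF assms(3)]
  by (auto simp: kronecker_def)

text \<open>The identity factor couples only positions with equal offset, which collapses the inner
  sum and leaves a sum over block numbers.\<close>

lemma kronecker_one_mult_entry:
  assumes A: "A \<in> carrier_mat p p" and B: "B \<in> carrier_mat (p * m) s" and i: "i < p * m" and j: "j < s"
  shows "((A \<otimes>\<^sub>K 1\<^sub>m m) * B) $$ (i, j) = (\<Sum>k<p. A $$ (i div m, k) * B $$ (k * m + i mod m, j))"
proof -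
  note bi = block_index_bounds[OF i]
  have "((A \<otimes>\<^sub>K 1\<^sub>m m) * B) $$ (i, j) =
      (\<Sum>k<p. \<Sum>t<m. (A \<otimes>\<^sub>K 1\<^sub>m m) $$ (i, k * m + t) * B $$ (k * m + t, j))"
    by (simp only: mult_mat_entry[OF kronecker_one_carrier[OF A] B i j] sum_blocks)
  also have "\<dots> = (\<Sum>k<p. \<Sum>t<m. if t = i mod m then A $$ (i div m, k) * B $$ (k * m + t, j) else 0)"
    using i by (intro sum.cong) (auto simp: kronecker_one_entry[OF A] block_index_div_mod)
  also have "\<dots> = (\<Sum>k<p. A $$ (i div m, k) * B $$ (k * m + i mod m, j))"
    using bi by (simp add: sum.delta)
  finally show ?thesis .
qed

lemma mult_kronecker_one_entry:
  assumes A: "A \<in> carrier_mat p p" and B: "B \<in> carrier_mat s (p * m)" and i: "i < s" and j: "j < p * m"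
  shows "(B * (A \<otimes>\<^sub>K 1\<^sub>m m)) $$ (i, j) = (\<Sum>k<p. B $$ (i, k * m + j mod m) * A $$ (k, j div m))"
proof -
  note bj = block_index_bounds[OF j]
  have "(B * (A \<otimes>\<^sub>K 1\<^sub>m m)) $$ (i, j) =
      (\<Sum>k<p. \<Sum>t<m. B $$ (i, k * m + t) * (A \<otimes>\<^sub>K 1\<^sub>m m) $$ (k * m + t, j))"
    by (simp only: mult_mat_entry[OF B kronecker_one_carrier[OF A] i j] sum_blocks)
  also have "\<dots> = (\<Sum>k<p. \<Sum>t<m. if t = j mod m then B $$ (i, k * m + t) * A $$ (k, j div m) else 0)"
    using j by (intro sum.cong) (auto simp: kronecker_one_entry[OF A] block_index_div_mod)
  also have "\<dots> = (\<Sum>k<p. B $$ (i, k * m + j mod m) * A $$ (k, j div m))"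
    using bj by (simp add: sum.delta)
  finally show ?thesis .
qed

lemma kronecker_one_mult:
  assumes A: "A \<in> carrier_mat p p" and B: "B \<in> carrier_mat p p"
  shows "(A \<otimes>\<^sub>K 1\<^sub>m m) * (B \<otimes>\<^sub>K 1\<^sub>m m) = (A * B) \<otimes>\<^sub>K 1\<^sub>m m"
proof (rule eq_matI)
  note AB = kronecker_one_carrier[OF mult_carrier_mat[OF A B], of m]
  fix i j assume "i < dim_row ((A * B) \<otimes>\<^sub>K 1\<^sub>m m)" "j < dim_col ((A * B) \<otimes>\<^sub>K 1\<^sub>m m)"
  then have i: "i < p * m" and j: "j < p * m" using AB by auto
  note bi = block_index_bounds[OF i] and bj = block_index_bounds[OF j]
  show "((A \<otimes>\<^sub>K 1\<^sub>m m) * (B \<otimes>\<^sub>K 1\<^sub>m m)) $$ (i, j) = ((A * B) \<otimes>\<^sub>K 1\<^sub>m m) $$ (i, j)"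
    unfolding kronecker_one_mult_entry[OF A kronecker_one_carrier[OF B] i j]
      kronecker_one_entry[OF mult_carrier_mat[OF A B] i j] mult_mat_entry[OF A B bi(1) bj(1)]
    using bi j by (auto simp: kronecker_one_entry[OF B] block_index_div_mod intro!: sum.cong)
qed (use kronecker_one_carrier[OF A, of m] kronecker_one_carrier[OF B, of m]
      kronecker_one_carrier[OF mult_carrier_mat[OF A B], of m] in auto)

lemma kronecker_one_one: "1\<^sub>m p \<otimes>\<^sub>K 1\<^sub>m m = 1\<^sub>m (p * m)"
proof (rule eq_matI)
  fix i j assume "i < dim_row (1\<^sub>m (p * m) :: complex mat)" "j < dim_col (1\<^sub>m (p * m) :: complex mat)"
  then have i: "i < p * m" and j: "j < p * m" by auto
  have "i = j \<longleftrightarrow> i div m = j div m \<and> i mod m = j mod m"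
    by (metis div_mult_mod_eq)
  then show "(1\<^sub>m p \<otimes>\<^sub>K 1\<^sub>m m) $$ (i, j) = 1\<^sub>m (p * m) $$ (i, j)"
    unfolding kronecker_one_entry[OF one_carrier_mat i j]
    using block_index_bounds[OF i] block_index_bounds[OF j] i j by auto
qed (auto simp: kronecker_def)

lemma mat_adjoint_kronecker_one:
  assumes A: "A \<in> carrier_mat p p"
  shows "mat_adjoint (A \<otimes>\<^sub>K 1\<^sub>m m) = mat_adjoint A \<otimes>\<^sub>K 1\<^sub>m m"
proof (rule eq_matI)
  note cA = mat_adjoint_carrier[OF A] and kA = kronecker_one_carrier[OF A, of m]
  fix i j assume "i < dim_row (mat_adjoint A \<otimes>\<^sub>K 1\<^sub>m m)" "j < dim_col (mat_adjoint A \<otimes>\<^sub>K 1\<^sub>m m)"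
  then have i: "i < p * m" and j: "j < p * m" using kronecker_one_carrier[OF cA, of m] by auto
  show "mat_adjoint (A \<otimes>\<^sub>K 1\<^sub>m m) $$ (i, j) = (mat_adjoint A \<otimes>\<^sub>K 1\<^sub>m m) $$ (i, j)"
    unfolding kronecker_one_entry[OF cA i j]
    using A kA i j block_index_bounds[OF i] block_index_bounds[OF j]
    by (auto simp: kronecker_one_entry[OF A])
qed (use kronecker_one_carrier[OF A, of m] kronecker_one_carrier[OF mat_adjoint_carrier[OF A], of m] in auto)

section \<open>The discrete Fourier transform\<close>

lemma dft_mat_carrier: "dft_mat p \<in> carrier_mat p p"
  by (simp add: dft_mat_def)

text \<open>The root has a negative exponent; powers are written as conjugates of \<open>cis\<close>
  with a positive angle to match the standard enumeration of the roots of unity, whose injectivity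
  is needed for the unitarity of the Fourier matrix.\<close>

lemma dft_root_power:
  assumes "p > 0"
  defines "w \<equiv> exp (- 2 * of_real pi * \<i> / of_nat p)"
  shows "w ^ a = cnj (cis (2 * pi * real a / real p))" "w ^ p = 1" "w * cnj w = 1"
proof -
  have "w = cis (- (2 * pi / real p))"
    unfolding w_def cis_conv_exp by (simp add: mult.commute)
  then have w: "w = cnj (cis (2 * pi / real p))" by (simp only: cis_cnj)
  show a: "w ^ a = cnj (cis (2 * pi * real a / real p))" for a
    unfolding w complex_cnj_power[symmetric] DeMoivre by (simp add: mult.commute)
  show "w ^ p = 1" using assms(1) unfolding a by simp
  show "w * cnj w = 1" unfolding w by (simp add: cis_cnj cis_mult)
qed

lemma dft_root_power_mod:
  assumes "p > 0" "a mod p = b mod p"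
  defines "w \<equiv> exp (- 2 * of_real pi * \<i> / of_nat p)"
  shows "w ^ a = w ^ b"
proof -
  have "w ^ a = w ^ (a mod p)" for a
  proof -
    have "w ^ (a div p * p + a mod p) = w ^ (a mod p)"
      using dft_root_power(2)[OF assms(1)] by (simp only: power_add power_mult w_def mult.commute[of _ p]) simp
    then show ?thesis by simp
  qed
  then show ?thesis using assms(2) by metis
qed

lemma dft_mat_unitary:
  assumes p: "p > 0"
  shows "dft_mat p * mat_adjoint (dft_mat p) = 1\<^sub>m p" "mat_adjoint (dft_mat p) * dft_mat p = 1\<^sub>m p"
proof -
  define w where "w = exp (- 2 * of_real pi * \<i> / of_nat p)"
  note root = dft_root_power[OF p, folded w_def]
  note c = dft_mat_carrier[of p] mat_adjoint_carrier[OF dft_mat_carrier[of p]]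
  show *: "dft_mat p * mat_adjoint (dft_mat p) = 1\<^sub>m p"
  proof (rule eq_matI)
    fix i j assume "i < dim_row (1\<^sub>m p :: complex mat)" "j < dim_col (1\<^sub>m p :: complex mat)"
    then have i: "i < p" and j: "j < p" by auto
    \<comment> \<open>This is w^(i - j), with conjugation in place of a negative exponent; entry (i,
      j) becomes a geometric sum in z.\<close>
    define z where "z = w ^ i * cnj (w ^ j)"
    have "(dft_mat p * mat_adjoint (dft_mat p)) $$ (i, j) =
        (\<Sum>k<p. dft_mat p $$ (i, k) * mat_adjoint (dft_mat p) $$ (k, j))"
      by (rule mult_mat_entry[OF c i j])
    also have "\<dots> = (\<Sum>k<p. z ^ k / of_nat p)"
      using i j by (intro sum.cong)
        (auto simp: dft_mat_def w_def z_def power_mult power_mult_distrib of_real_mult[symmetric]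
          simp del: of_real_mult)
    also have "\<dots> = (\<Sum>k<p. z ^ k) / of_nat p" by (simp add: sum_divide_distrib)
    also have "\<dots> = (if i = j then 1 else 0)"
    proof (cases "i = j")
      case True
      then have "z = (w * cnj w) ^ i" by (simp add: z_def power_mult_distrib)
      then have "z = 1" by (simp add: root(3))
      then show ?thesis using True p by simp
    next
      case False
      have "inj_on (\<lambda>k. cis (2 * pi * real k / real p)) {..<p}"
        using bij_betw_roots_unity[OF p] by (simp add: bij_betw_def)
      then have "w ^ i \<noteq> w ^ j" unfolding root(1) using False i j by (auto dest!: inj_onD)
      moreover have "z * w ^ j = w ^ i"
      proof -
        have "z * w ^ j = w ^ i * (w * cnj w) ^ j" by (simp add: z_def power_mult_distrib)
        then show ?thesis by (simp add: root(3))
      qed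
      ultimately have "z \<noteq> 1" by auto
      moreover have "z ^ p = 1"
      proof -
        have "z ^ p = (w ^ p) ^ i * cnj ((w ^ p) ^ j)"
          by (simp add: z_def power_mult_distrib power_mult[symmetric] mult.commute)
        then show ?thesis by (simp add: root(2))
      qed
      \<comment> \<open>The geometric sum is (z^p - 1) / (z - 1) up to sign in numerator and
        denominator, hence 0.\<close>
      ultimately show ?thesis using False by (simp add: sum_gp_strict)
    qed
    finally show "(dft_mat p * mat_adjoint (dft_mat p)) $$ (i, j) = 1\<^sub>m p $$ (i, j)"
      using i j by simp
  qed (use c in auto)
  show "mat_adjoint (dft_mat p) * dft_mat p = 1\<^sub>m p"
    using mat_mult_left_right_inverse[OF c *] .
qed

section \<open>Block circulant matrices and the Fourier transform\<close>

text \<open>Slice \<open>a\<close> is block (a, 0) of \<open>fourier_block_diag m n p Ds\<close>.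
  This is the explicit preimage of that matrix under \<open>bcirc\<close>, up to normalisation a
  discrete Fourier transform along the third dimension.\<close>

definition fourier_tensor :: "nat \<Rightarrow> nat \<Rightarrow> nat \<Rightarrow> complex mat list \<Rightarrow> tensor" where
  "fourier_tensor m n p Ds = map (\<lambda>a. mat m n (\<lambda>(i, j).
     \<Sum>k<p. dft_mat p $$ (a, k) * Ds ! k $$ (i, j) * cnj (dft_mat p $$ (0, k)))) [0..<p]"

context
  fixes p :: nat
  assumes p: "p > 0"
begin

lemma kronecker_dft_unitary:
  "mat_adjoint (dft_mat p \<otimes>\<^sub>K 1\<^sub>m m) * (dft_mat p \<otimes>\<^sub>K 1\<^sub>m m) = 1\<^sub>m (p * m)"
  "(dft_mat p \<otimes>\<^sub>K 1\<^sub>m m) * mat_adjoint (dft_mat p \<otimes>\<^sub>K 1\<^sub>m m) = 1\<^sub>m (p * m)"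
  unfolding mat_adjoint_kronecker_one[OF dft_mat_carrier]
    kronecker_one_mult[OF mat_adjoint_carrier[OF dft_mat_carrier] dft_mat_carrier]
    kronecker_one_mult[OF dft_mat_carrier mat_adjoint_carrier[OF dft_mat_carrier]]
    dft_mat_unitary[OF p] kronecker_one_one by simp_all

lemma fourier_block_diag_altdef:
  "fourier_block_diag m n p Ds =
     (dft_mat p \<otimes>\<^sub>K 1\<^sub>m m) * diag_block_mat Ds * mat_adjoint (dft_mat p \<otimes>\<^sub>K 1\<^sub>m n)"
  by (simp add: fourier_block_diag_def mat_adjoint_kronecker_one[OF dft_mat_carrier])

lemma fourier_block_diag_carrier:
  assumes "length Ds = p" "\<forall>D\<in>set Ds. D \<in> carrier_mat m n"
  shows "fourier_block_diag m n p Ds \<in> carrier_mat (p * m) (p * n)"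
  unfolding fourier_block_diag_altdef
  using kronecker_one_carrier[OF dft_mat_carrier[of p]] diag_block_mat_equal_blocks(1)[OF assms(2)]
  by (auto simp: assms(1) intro!: mult_carrier_mat)

text \<open>The inner Fourier factors cancel by unitarity, which reduces the product to one of block
  diagonal matrices.\<close>

lemma fourier_block_diag_mult:
  assumes "length Ds = p" "\<forall>D\<in>set Ds. D \<in> carrier_mat m n"
    and "length Es = p" "\<forall>E\<in>set Es. E \<in> carrier_mat n s"
  shows "fourier_block_diag m n p Ds * fourier_block_diag n s p Es
       = fourier_block_diag m s p (map2 (*) Ds Es)"
proof -
  let ?K = "\<lambda>m. dft_mat p \<otimes>\<^sub>K 1\<^sub>m m" and ?D = "diag_block_mat Ds" and ?E = "diag_block_mat Es"
  note K = kronecker_one_carrier[OF dft_mat_carrier[of p]]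
  note K' = mat_adjoint_carrier[OF K]
  have D: "?D \<in> carrier_mat (p * m) (p * n)" and E: "?E \<in> carrier_mat (p * n) (p * s)"
    using diag_block_mat_equal_blocks(1) assms by metis+
  have "?K m * ?D * mat_adjoint (?K n) * (?K n * ?E * mat_adjoint (?K s))
      = ?K m * ?D * (mat_adjoint (?K n) * (?K n * (?E * mat_adjoint (?K s))))"
    unfolding assoc_mult_mat[OF K E K']
    by (rule assoc_mult_mat[OF mult_carrier_mat[OF K D] K' mult_carrier_mat[OF K mult_carrier_mat[OF E K']]])
  also have "\<dots> = ?K m * ?D * (?E * mat_adjoint (?K s))"
    unfolding assoc_mult_mat[OF K' K mult_carrier_mat[OF E K'], symmetric] kronecker_dft_unitary
      left_mult_one_mat[OF mult_carrier_mat[OF E K']] ..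
  also have "\<dots> = ?K m * (?D * ?E) * mat_adjoint (?K s)"
    unfolding assoc_mult_mat[OF mult_carrier_mat[OF K D] E K', symmetric] assoc_mult_mat[OF K D E] ..
  finally show ?thesis
    unfolding fourier_block_diag_altdef diag_block_mat_mult[OF assms(2,4,1,3)] .
qed

lemma mat_adjoint_fourier_block_diag:
  assumes "length Ds = p" "\<forall>D\<in>set Ds. D \<in> carrier_mat m n"
  shows "mat_adjoint (fourier_block_diag m n p Ds) = fourier_block_diag n m p (map mat_adjoint Ds)"
proof -
  note K = kronecker_one_carrier[OF dft_mat_carrier[of p]]
  note K' = mat_adjoint_carrier[OF K]
  have D: "diag_block_mat Ds \<in> carrier_mat (p * m) (p * n)"
    using diag_block_mat_equal_blocks(1)[OF assms(2)] assms(1) by metis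
  show ?thesis
    unfolding fourier_block_diag_altdef mat_adjoint_mult[OF mult_carrier_mat[OF K D] K']
      mat_adjoint_mult[OF K D] mat_adjoint_diag_block_mat[OF assms(2), symmetric] mat_adjoint_adjoint
    by (rule assoc_mult_mat[OF K mat_adjoint_carrier[OF D] K', symmetric])
qed

lemma fourier_block_diag_one:
  "fourier_block_diag n n p (replicate p (1\<^sub>m n)) = 1\<^sub>m (p * n)"
  unfolding fourier_block_diag_altdef diag_block_mat_one
    right_mult_one_mat[OF kronecker_one_carrier[OF dft_mat_carrier]] kronecker_dft_unitary ..

lemma fourier_block_diag_entry:
  assumes "length Ds = p" "\<forall>D\<in>set Ds. D \<in> carrier_mat m n" and i: "i < p * m" and j: "j < p * n"
  shows "fourier_block_diag m n p Ds $$ (i, j) =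
    (\<Sum>k<p. dft_mat p $$ (i div m, k) * Ds ! k $$ (i mod m, j mod n) * cnj (dft_mat p $$ (j div n, k)))"
proof -
  note F' = mat_adjoint_carrier[OF dft_mat_carrier[of p]]
  note K = kronecker_one_carrier[OF dft_mat_carrier[of p]] and bi = block_index_bounds[OF i]
    and bj = block_index_bounds[OF j]
  have D: "diag_block_mat Ds \<in> carrier_mat (p * m) (p * n)"
    using diag_block_mat_equal_blocks(1)[OF assms(2)] assms(1) by metis
  have d: "diag_block_mat Ds $$ (k * m + i mod m, l * n + j mod n) =
      (if k = l then Ds ! k $$ (i mod m, j mod n) else 0)" if "k < p" "l < p" for k l
    using diag_block_mat_equal_blocks(2)[OF assms(2), unfolded assms(1)] that bi bj
    by (simp add: block_index_div_mod)
  have "fourier_block_diag m n p Ds $$ (i, j) =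
    (\<Sum>l<p. ((dft_mat p \<otimes>\<^sub>K 1\<^sub>m m) * diag_block_mat Ds) $$ (i, l * n + j mod n) *
      mat_adjoint (dft_mat p) $$ (l, j div n))"
    unfolding fourier_block_diag_def
    by (rule mult_kronecker_one_entry[OF F' mult_carrier_mat[OF K D] i j])
  also have "\<dots> = (\<Sum>l<p. dft_mat p $$ (i div m, l) * Ds ! l $$ (i mod m, j mod n) *
      cnj (dft_mat p $$ (j div n, l)))"
  proof (intro sum.cong refl)
    fix l assume "l \<in> {..<p}"
    then have l: "l < p" by simp
    have "((dft_mat p \<otimes>\<^sub>K 1\<^sub>m m) * diag_block_mat Ds) $$ (i, l * n + j mod n) =
      (\<Sum>k<p. dft_mat p $$ (i div m, k) * diag_block_mat Ds $$ (k * m + i mod m, l * n + j mod n))"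
      by (rule kronecker_one_mult_entry[OF dft_mat_carrier D i block_index_div_mod(1)[OF l bj(2)]])
    also have "\<dots> = (\<Sum>k<p. if k = l then dft_mat p $$ (i div m, l) * Ds ! l $$ (i mod m, j mod n) else 0)"
      using d l by (intro sum.cong) auto
    also have "\<dots> = dft_mat p $$ (i div m, l) * Ds ! l $$ (i mod m, j mod n)"
      using l by (simp add: sum.delta)
    finally show "((dft_mat p \<otimes>\<^sub>K 1\<^sub>m m) * diag_block_mat Ds) $$ (i, l * n + j mod n) *
        mat_adjoint (dft_mat p) $$ (l, j div n) = dft_mat p $$ (i div m, l) *
        Ds ! l $$ (i mod m, j mod n) * cnj (dft_mat p $$ (j div n, l))"
      using l bj dft_mat_carrier[of p] by (subst mat_adjoint_entry) auto
  qed
  finally show ?thesis .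
qed

lemma tensorsI:
  assumes "length A = p" "\<And>k. k < p \<Longrightarrow> A ! k \<in> carrier_mat m n"
  shows "A \<in> tensors m n p"
  using assms by (auto simp: tensors_def in_set_conv_nth)

lemma bcirc_carrier:
  assumes "A \<in> tensors m n p"
  shows "bcirc A \<in> carrier_mat (p * m) (p * n)"
  by (simp add: bcirc_def tensors_dims[OF assms p] mult.commute)

lemma bcirc_entry:
  assumes "A \<in> tensors m n p" "i < p * m" "j < p * n"
  shows "bcirc A $$ (i, j) =
    A ! nat ((int (i div m) - int (j div n)) mod int p) $$ (i mod m, j mod n)"
  using assms(2,3) by (simp add: bcirc_def tensors_dims[OF assms(1) p] mult.commute)

text \<open>In the first block column the circulant index (a - 0) mod p is a itself, so this column
  is the stack of the slices.\<close>

lemma unfold_tensor_eq_bcirc: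
  assumes A: "A \<in> tensors m n p"
  shows "unfold_tensor A = mat (p * m) n (\<lambda>ij. bcirc A $$ ij)"
proof (rule eq_matI)
  fix i j
  assume "i < dim_row (mat (p * m) n (\<lambda>ij. bcirc A $$ ij))" "j < dim_col (mat (p * m) n (\<lambda>ij. bcirc A $$ ij))"
  then have i: "i < p * m" and j: "j < n" by auto
  have "j < p * n" using block_index_less[OF p j] by simp
  moreover have "nat (int (i div m) mod int p) = i div m"
    using block_index_bounds[OF i] by simp
  ultimately show "unfold_tensor A $$ (i, j) = mat (p * m) n (\<lambda>ij. bcirc A $$ ij) $$ (i, j)"
    using i j bcirc_entry[OF A i] by (simp add: unfold_tensor_def tensors_dims[OF A p])
qed (simp_all add: unfold_tensor_def tensors_dims[OF A p])

lemma fourier_tensor_tensors: "fourier_tensor m n p Ds \<in> tensors m n p"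
  by (rule tensorsI) (simp_all add: fourier_tensor_def)

text \<open>The product of row a with the conjugate of row b depends only on a - b modulo p, because
  w^p = 1 and conjugation inverts w. This is why Fourier conjugation of a block diagonal matrix
  gives a block circulant one. The factor from row 0 contributes the second 1 / sqrt p.\<close>

lemma dft_mat_shift:
  assumes a: "a < p" and b: "b < p" and k: "k < p"
  shows "dft_mat p $$ (nat ((int a - int b) mod int p), k) * cnj (dft_mat p $$ (0, k)) =
    dft_mat p $$ (a, k) * cnj (dft_mat p $$ (b, k))"
proof -
  define w where "w = exp (- 2 * of_real pi * \<i> / of_nat p)"
  note root = dft_root_power[OF p, folded w_def]
  define c where "c = nat ((int a - int b) mod int p)"
  have ci: "int c = (int a - int b) mod int p" and c: "c < p"
    using p by (auto simp: c_def nat_less_iff)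
  \<comment> \<open>Adding b back avoids negative exponents; w^b is moved to the other side
    afterwards by w * cnj w = 1.\<close>
  have "int ((c + b) mod p) = int (a mod p)" by (simp add: zmod_int ci mod_simps)
  then have "(c + b) mod p = a mod p" by linarith
  then have "w ^ (c + b) = w ^ a"
    using dft_root_power_mod[OF p] unfolding w_def by blast
  then have "w ^ a * cnj (w ^ b) = w ^ c * (w * cnj w) ^ b"
    by (simp add: power_add[symmetric] power_mult_distrib flip: mult.assoc)
  then have "w ^ c = w ^ a * cnj (w ^ b)" by (simp add: root(3))
  then have "w ^ (c * k) = w ^ (a * k) * cnj (w ^ (b * k))"
    by (simp add: power_mult power_mult_distrib)
  moreover have "dft_mat p $$ (l, k) = w ^ (l * k) / of_real (sqrt (real p))" if "l < p" for l
    using that k by (simp add: dft_mat_def w_def)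
  ultimately show ?thesis
    unfolding c_def[symmetric] using a b c p by simp
qed

lemma bcirc_fourier_tensor:
  assumes Ds: "length Ds = p" "\<forall>D\<in>set Ds. D \<in> carrier_mat m n"
  shows "bcirc (fourier_tensor m n p Ds) = fourier_block_diag m n p Ds"
proof (rule eq_matI)
  note c = fourier_block_diag_carrier[OF Ds]
  fix i j
  assume "i < dim_row (fourier_block_diag m n p Ds)" "j < dim_col (fourier_block_diag m n p Ds)"
  then have i: "i < p * m" and j: "j < p * n" using c by auto
  note bi = block_index_bounds[OF i] and bj = block_index_bounds[OF j]
  have l: "nat ((int (i div m) - int (j div n)) mod int p) < p"
    using p by (simp add: nat_less_iff)
  show "bcirc (fourier_tensor m n p Ds) $$ (i, j) = fourier_block_diag m n p Ds $$ (i, j)"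
    unfolding bcirc_entry[OF fourier_tensor_tensors i j] fourier_block_diag_entry[OF Ds i j]
    using l bi bj dft_mat_shift[OF bi(1) bj(1)]
    by (auto simp: fourier_tensor_def mult.commute mult.left_commute intro!: sum.cong)
qed (use fourier_block_diag_carrier[OF Ds] bcirc_carrier[OF fourier_tensor_tensors, of m n Ds] in auto)

text \<open>This places the argument of \<open>bcirc_inv\<close> in \<open>f_hat\<close> inside the
  image of \<open>bcirc\<close>, where the inverse is meaningful, and makes it explicit.\<close>

lemma bcirc_inv_fourier_block_diag:
  assumes "length Ds = p" "\<forall>D\<in>set Ds. D \<in> carrier_mat m n"
  shows "bcirc_inv m n p (fourier_block_diag m n p Ds) = fourier_tensor m n p Ds"
  unfolding bcirc_fourier_tensor[OF assms, symmetric]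
  by (rule bcirc_inv_bcirc[OF fourier_tensor_tensors p])

lemma fourier_tensor_surj:
  assumes A: "A \<in> tensors m n p"
  obtains Ds where "length Ds = p" "\<forall>D\<in>set Ds. D \<in> carrier_mat m n" "A = fourier_tensor m n p Ds"
proof -
  \<comment> \<open>The inverse transform; the factor sqrt p compensates
    \<open>cnj (dft_mat p $$ (0, k))\<close>, which is 1 / sqrt p, in
    \<open>fourier_tensor\<close>.\<close>
  define Ds where "Ds = map (\<lambda>k. mat m n (\<lambda>(i, j).
    \<Sum>a<p. of_real (sqrt (real p)) * cnj (dft_mat p $$ (a, k)) * A ! a $$ (i, j))) [0..<p]"
  note c = dft_mat_carrier[of p] and c' = mat_adjoint_carrier[OF dft_mat_carrier[of p]]
  have orth: "(\<Sum>k<p. dft_mat p $$ (a, k) * cnj (dft_mat p $$ (b, k))) = (if a = b then 1 else 0)"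
    if a: "a < p" and b: "b < p" for a b
  proof -
    have "(\<Sum>k<p. dft_mat p $$ (a, k) * cnj (dft_mat p $$ (b, k))) =
        (dft_mat p * mat_adjoint (dft_mat p)) $$ (a, b)"
      unfolding mult_mat_entry[OF c c' a b] using b c by (intro sum.cong) auto
    then show ?thesis using a b by (simp add: dft_mat_unitary[OF p])
  qed
  have len: "length Ds = p" "\<forall>D\<in>set Ds. D \<in> carrier_mat m n" by (auto simp: Ds_def)
  have "A ! a = fourier_tensor m n p Ds ! a" if a: "a < p" for a
  proof (rule eq_matI)
    fix i j
    assume "i < dim_row (fourier_tensor m n p Ds ! a)" "j < dim_col (fourier_tensor m n p Ds ! a)"
    then have i: "i < m" and j: "j < n" using a by (auto simp: fourier_tensor_def)
    have "fourier_tensor m n p Ds ! a $$ (i, j) =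
      (\<Sum>k<p. \<Sum>b<p. dft_mat p $$ (a, k) * cnj (dft_mat p $$ (b, k)) * A ! b $$ (i, j))"
      using a i j p by (auto simp: fourier_tensor_def Ds_def dft_mat_def sum_distrib_left
          sum_distrib_right divide_simps intro!: sum.cong)
    also have "\<dots> = (\<Sum>b<p. (\<Sum>k<p. dft_mat p $$ (a, k) * cnj (dft_mat p $$ (b, k))) * A ! b $$ (i, j))"
      by (subst sum.swap) (simp add: sum_distrib_right)
    also have "\<dots> = (\<Sum>b<p. if b = a then A ! a $$ (i, j) else 0)"
      using orth[OF a] by (intro sum.cong) auto
    also have "\<dots> = A ! a $$ (i, j)" using a by (simp add: sum.delta)
    finally show "A ! a $$ (i, j) = fourier_tensor m n p Ds ! a $$ (i, j)" ..
  qed (use tensors_dims(4)[OF A p a] a in \<open>auto simp: fourier_tensor_def\<close>)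
  then have "A = fourier_tensor m n p Ds"
    using tensors_dims(1)[OF A p] by (intro nth_equalityI) (auto simp: fourier_tensor_def)
  then show thesis using that len by blast
qed

section \<open>The T-product\<close>

text \<open>A product of block circulant matrices is block circulant by the Fourier representation, and
  a block circulant matrix is determined by its first block column, where
  the claim is the definition of the T-product.\<close>

lemma tprod_bcirc:
  assumes A: "A \<in> tensors m n p" and B: "B \<in> tensors n s p"
  shows "A *\<^sub>T B \<in> tensors m s p" "bcirc (A *\<^sub>T B) = bcirc A * bcirc B"
proof -
  obtain Ds where Ds: "length Ds = p" "\<forall>D\<in>set Ds. D \<in> carrier_mat m n" "A = fourier_tensor m n p Ds"
    using fourier_tensor_surj[OF A] by blast
  obtain Es where Es: "length Es = p" "\<forall>D\<in>set Es. D \<in> carrier_mat n s" "B = fourier_tensor n s p Es"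
    using fourier_tensor_surj[OF B] by blast
  define C where "C = fourier_tensor m s p (map2 (*) Ds Es)"
  have C: "C \<in> tensors m s p" unfolding C_def by (rule fourier_tensor_tensors)
  have P: "length (map2 (*) Ds Es) = p" "\<forall>D\<in>set (map2 (*) Ds Es). D \<in> carrier_mat m s"
    using Ds Es by (auto simp: set_zip intro!: mult_carrier_mat)
  have bc: "bcirc C = bcirc A * bcirc B"
    unfolding C_def bcirc_fourier_tensor[OF P] Ds(3) Es(3) bcirc_fourier_tensor[OF Ds(1,2)]
      bcirc_fourier_tensor[OF Es(1,2)] fourier_block_diag_mult[OF Ds(1,2) Es(1,2)] ..
  note bA = bcirc_carrier[OF A] and bB = bcirc_carrier[OF B]
  have uB: "unfold_tensor B \<in> carrier_mat (p * n) s" by (simp add: unfold_tensor_eq_bcirc[OF B])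
  have "bcirc A * unfold_tensor B = unfold_tensor C"
  proof (rule eq_matI)
    fix i j assume "i < dim_row (unfold_tensor C)" "j < dim_col (unfold_tensor C)"
    then have i: "i < p * m" and j: "j < s" by (auto simp: unfold_tensor_eq_bcirc[OF C])
    have j': "j < p * s" using block_index_less[OF p j] by simp
    show "(bcirc A * unfold_tensor B) $$ (i, j) = unfold_tensor C $$ (i, j)"
      unfolding mult_mat_entry[OF bA uB i j]
      using i j mult_mat_entry[OF bA bB i j'] bc
      by (simp add: unfold_tensor_eq_bcirc[OF C] unfold_tensor_eq_bcirc[OF B] del: index_mult_mat)
  qed (use bA uB in \<open>auto simp: unfold_tensor_eq_bcirc[OF C]\<close>)
  then have "A *\<^sub>T B = C"
    by (simp add: tprod_def tensors_dims(1)[OF A p] fold_unfold_tensor[OF C p])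
  then show "A *\<^sub>T B \<in> tensors m s p" "bcirc (A *\<^sub>T B) = bcirc A * bcirc B"
    using C bc by auto
qed

text \<open>Keeping the first slice and reversing the others is the index map k to -k modulo p,
  written here in natural numbers.\<close>

lemma tadjoint_nth:
  assumes A: "A \<in> tensors m n p" and k: "k < p"
  shows "tadjoint A ! k = mat_adjoint (A ! ((p - k) mod p))"
proof -
  have len: "length A = p" using tensors_dims(1)[OF A p] .
  then obtain X Xs where X: "A = X # Xs" using p by (cases A) auto
  show ?thesis
  proof (cases k)
    case 0
    then show ?thesis using X p by (simp add: tadjoint_def)
  next
    case (Suc l)
    have l: "l < length Xs" "p = Suc (length Xs)" using k Suc len X by auto
    then have "(p - k) mod p = Suc (length Xs - Suc l)" using Suc by auto
    then show ?thesis using X Suc l by (simp add: tadjoint_def rev_nth)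
  qed
qed

text \<open>Transposition exchanges the block numbers and so negates the circulant index a - b
  modulo p; the slice order of \<open>tadjoint\<close> is made to undo this.\<close>

lemma tadjoint_bcirc:
  assumes A: "A \<in> tensors m n p"
  shows "tadjoint A \<in> tensors n m p" "bcirc (tadjoint A) = mat_adjoint (bcirc A)"
proof -
  have "length (tadjoint A) = p"
    using tensors_dims(1)[OF A p] p by (cases A) (auto simp: tadjoint_def)
  moreover have "tadjoint A ! k \<in> carrier_mat n m" if "k < p" for k
    using tadjoint_nth[OF A that] tensors_dims(4)[OF A p] p by simp
  ultimately show T: "tadjoint A \<in> tensors n m p" by (rule tensorsI)
  note bA = bcirc_carrier[OF A]
  show "bcirc (tadjoint A) = mat_adjoint (bcirc A)"
  proof (rule eq_matI)
    fix i j assume "i < dim_row (mat_adjoint (bcirc A))" "j < dim_col (mat_adjoint (bcirc A))"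
    then have i: "i < p * n" and j: "j < p * m" using bA by auto
    note bi = block_index_bounds[OF i] and bj = block_index_bounds[OF j]
    define k where "k = nat ((int (i div n) - int (j div m)) mod int p)"
    define l where "l = nat ((int (j div m) - int (i div n)) mod int p)"
    have k: "k < p" "int k = (int (i div n) - int (j div m)) mod int p"
      and l: "l < p" "int l = (int (j div m) - int (i div n)) mod int p"
      using p by (auto simp: k_def l_def nat_less_iff)
    have "int ((p - k) mod p) = (- int k) mod int p"
      using k(1) by (simp add: zmod_int of_nat_diff mod_simps)
    also have "\<dots> = int l" unfolding k(2) l(2) by (simp add: mod_simps)
    finally have "(p - k) mod p = l" by linarith
    then show "bcirc (tadjoint A) $$ (i, j) = mat_adjoint (bcirc A) $$ (i, j)"
      using i j bA bi bj tensors_dims(4)[OF A p l(1)] tadjoint_nth[OF A k(1)]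
      by (simp add: bcirc_entry[OF T i j] bcirc_entry[OF A j i] flip: k_def l_def)
  qed (use bA bcirc_carrier[OF T] in auto)
qed

lemma identity_tensor_bcirc:
  "identity_tensor n p \<in> tensors n n p" "bcirc (identity_tensor n p) = 1\<^sub>m (p * n)"
proof -
  have nth: "identity_tensor n p ! k = (if k = 0 then 1\<^sub>m n else 0\<^sub>m n n)" if "k < p" for k
    using that by (cases k) (auto simp: identity_tensor_def)
  show T: "identity_tensor n p \<in> tensors n n p"
    using p nth by (intro tensorsI) (auto simp: identity_tensor_def)
  show "bcirc (identity_tensor n p) = 1\<^sub>m (p * n)"
  proof (rule eq_matI)
    fix i j assume "i < dim_row (1\<^sub>m (p * n) :: complex mat)" "j < dim_col (1\<^sub>m (p * n) :: complex mat)"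
    then have i: "i < p * n" and j: "j < p * n" by auto
    note bi = block_index_bounds[OF i] and bj = block_index_bounds[OF j]
    define k where "k = nat ((int (i div n) - int (j div n)) mod int p)"
    have k: "k < p" "int k = (int (i div n) - int (j div n)) mod int p"
      using p by (auto simp: k_def nat_less_iff)
    have "k = 0 \<longleftrightarrow> (int (i div n) - int (j div n)) mod int p = 0" using k(2) by linarith
    also have "\<dots> \<longleftrightarrow> int (i div n) mod int p = int (j div n) mod int p"
      by (simp add: mod_eq_dvd_iff dvd_eq_mod_eq_0)
    also have "\<dots> \<longleftrightarrow> i div n = j div n" using bi bj by simp
    finally have "k = 0 \<longleftrightarrow> i div n = j div n" .
    moreover have "i = j \<longleftrightarrow> i div n = j div n \<and> i mod n = j mod n"
      by (metis div_mult_mod_eq)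
    ultimately show "bcirc (identity_tensor n p) $$ (i, j) = 1\<^sub>m (p * n) $$ (i, j)"
      using i j bi bj nth[OF k(1)] by (simp add: bcirc_entry[OF T i j] flip: k_def)
  qed (use bcirc_carrier[OF T] in auto)
qed

text \<open>By injectivity of \<open>bcirc\<close>, the tensor equations hold exactly when their
  images do, and those are ordinary matrix equations.\<close>

lemma unitary_tensor_iff:
  assumes Q: "Q \<in> tensors n n p"
  shows "unitary_tensor n p Q \<longleftrightarrow>
    mat_adjoint (bcirc Q) * bcirc Q = 1\<^sub>m (p * n) \<and> bcirc Q * mat_adjoint (bcirc Q) = 1\<^sub>m (p * n)"
proof -
  note T = tadjoint_bcirc[OF Q] and I = identity_tensor_bcirc[of n]
  have "R = identity_tensor n p \<longleftrightarrow> bcirc R = 1\<^sub>m (p * n)" if "R \<in> tensors n n p" for R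
    using inj_onD[OF bcirc_inj[OF p] _ that I(1)] I(2) by auto
  then show ?thesis
    using Q tprod_bcirc[OF T(1) Q] tprod_bcirc[OF Q T(1)] T(2) by (simp add: unitary_tensor_def)
qed

end

section \<open>Isometries\<close>

definition isometry_mat :: "nat \<Rightarrow> nat \<Rightarrow> complex mat \<Rightarrow> bool" where
  "isometry_mat m r U \<longleftrightarrow> U \<in> carrier_mat m r \<and> mat_adjoint U * U = 1\<^sub>m r"

lemma isometry_mat_iff:
  "isometry_mat m r U \<longleftrightarrow> U \<in> carrier_mat m r \<and>
     (\<forall>i<r. \<forall>j<r. (\<Sum>k<m. cnj (U $$ (k, i)) * U $$ (k, j)) = (if i = j then 1 else 0))"
proof (cases "U \<in> carrier_mat m r")
  case U: True
  note U' = mat_adjoint_carrier[OF U]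
  have *: "(mat_adjoint U * U) $$ (i, j) = (\<Sum>k<m. cnj (U $$ (k, i)) * U $$ (k, j))"
    if "i < r" "j < r" for i j
    unfolding mult_mat_entry[OF U' U that] using that U by (intro sum.cong) auto
  have "mat_adjoint U * U = 1\<^sub>m r \<longleftrightarrow>
      (\<forall>i<r. \<forall>j<r. (mat_adjoint U * U) $$ (i, j) = (1\<^sub>m r :: complex mat) $$ (i, j))"
    using U U' by (auto simp del: index_mult_mat(1) intro!: eq_matI)
  then show ?thesis using U * by (simp add: isometry_mat_def)
qed (simp add: isometry_mat_def)

text \<open>The new column is a one-column matrix rather than a vector, so that the associativity
  and adjoint laws of matrices apply to it directly.\<close>

definition snoc_col :: "'a mat \<Rightarrow> 'a mat \<Rightarrow> 'a mat" where
  "snoc_col U w = mat (dim_row U) (Suc (dim_col U)) (\<lambda>(i, j). if j < dim_col U then U $$ (i, j) else w $$ (i, 0))"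

lemma snoc_col_carrier: "U \<in> carrier_mat m r \<Longrightarrow> snoc_col U w \<in> carrier_mat m (Suc r)"
  by (auto simp: snoc_col_def)

lemma snoc_col_entry:
  assumes "U \<in> carrier_mat m r" "i < m" "j < Suc r"
  shows "snoc_col U w $$ (i, j) = (if j < r then U $$ (i, j) else w $$ (i, 0))"
  using assms by (auto simp: snoc_col_def)

lemma isometry_mat_snoc_col:
  assumes U: "isometry_mat m r U" and w: "isometry_mat m 1 w"
    and orth: "mat_adjoint U * w = 0\<^sub>m r 1"
  shows "isometry_mat m (Suc r) (snoc_col U w)"
proof -
  have Uc: "U \<in> carrier_mat m r" and wc: "w \<in> carrier_mat m 1"
    using U w by (auto simp: isometry_mat_def)
  have o: "(\<Sum>k<m. cnj (U $$ (k, i)) * w $$ (k, 0)) = 0" if "i < r" for i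
  proof -
    have "(mat_adjoint U * w) $$ (i, 0) = (\<Sum>k<m. mat_adjoint U $$ (i, k) * w $$ (k, 0))"
      by (rule mult_mat_entry[OF mat_adjoint_carrier[OF Uc] wc that]) simp
    also have "\<dots> = (\<Sum>k<m. cnj (U $$ (k, i)) * w $$ (k, 0))"
      using that Uc by (intro sum.cong) auto
    finally show ?thesis using that by (simp add: orth del: index_mult_mat)
  qed
  have o': "(\<Sum>k<m. cnj (w $$ (k, 0)) * U $$ (k, i)) = 0" if "i < r" for i
    using arg_cong[OF o[OF that], of cnj] by (simp add: mult.commute)
  show ?thesis
    unfolding isometry_mat_iff
    using U w snoc_col_carrier[OF Uc] o o'
    by (auto simp: isometry_mat_iff snoc_col_entry[OF Uc] less_Suc_eq)
qed

lemma gram_col: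
  assumes x: "x \<in> carrier_mat m 1"
  defines "a \<equiv> (\<Sum>k<m. (cmod (x $$ (k, 0)))\<^sup>2)"
  shows "mat_adjoint x * x = mat 1 1 (\<lambda>_. complex_of_real a)" "a \<ge> 0"
    "x \<noteq> 0\<^sub>m m 1 \<Longrightarrow> a > 0"
proof -
  have "(mat_adjoint x * x) $$ (0, 0) = complex_of_real a"
    unfolding mult_mat_entry[OF mat_adjoint_carrier[OF x] x, of 0 0, simplified] a_def of_real_sum
    using x by (intro sum.cong) (auto simp: complex_norm_square mult.commute simp flip: of_real_power)
  then show "mat_adjoint x * x = mat 1 1 (\<lambda>_. complex_of_real a)"
    using x by (intro eq_matI) (auto simp del: index_mult_mat(1))
  show "a \<ge> 0" unfolding a_def by (intro sum_nonneg) simp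
  assume "x \<noteq> 0\<^sub>m m 1"
  then obtain k where k: "k < m" "x $$ (k, 0) \<noteq> 0" using x by (metis One_nat_def carrier_matD eq_matI index_zero_mat less_Suc0)
  then show "a > 0" unfolding a_def by (intro sum_pos2[of _ k]) auto
qed

lemma isometry_mat_normalize:
  assumes x: "x \<in> carrier_mat m 1" and gram: "mat_adjoint x * x = mat 1 1 (\<lambda>_. complex_of_real a)" and a: "a > 0"
  shows "isometry_mat m 1 (complex_of_real (1 / sqrt a) \<cdot>\<^sub>m x)"
proof -
  have "(\<Sum>k<m. cnj (x $$ (k, 0)) * x $$ (k, 0)) = (mat_adjoint x * x) $$ (0, 0)"
    unfolding mult_mat_entry[OF mat_adjoint_carrier[OF x] x, of 0 0, simplified]
    using x by (intro sum.cong) auto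
  then have *: "(\<Sum>k<m. cnj (x $$ (k, 0)) * x $$ (k, 0)) = complex_of_real a"
    by (simp add: gram)
  have "(\<Sum>k<m. cnj ((complex_of_real (1 / sqrt a) \<cdot>\<^sub>m x) $$ (k, 0)) * (complex_of_real (1 / sqrt a) \<cdot>\<^sub>m x) $$ (k, 0))
      = (\<Sum>k<m. complex_of_real (1 / a) * (cnj (x $$ (k, 0)) * x $$ (k, 0)))"
    using x a by (intro sum.cong) (auto simp flip: of_real_mult simp: field_simps)
  also have "\<dots> = 1" unfolding sum_distrib_left[symmetric] * using a by simp
  finally show ?thesis using x by (simp add: isometry_mat_iff)
qed

text \<open>Fewer equations than unknowns: padding with zero rows gives a singular square matrix, to
  which the determinant criterion applies.\<close>

lemma nontrivial_kernel:
  fixes A :: "complex mat"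
  assumes A: "A \<in> carrier_mat r m" and "r < m"
  shows "\<exists>x \<in> carrier_mat m 1. x \<noteq> 0\<^sub>m m 1 \<and> A * x = 0\<^sub>m r 1"
proof -
  \<comment> \<open>Since \<open>r < m\<close>, row \<open>m - 1\<close> lies below all rows of
    \<open>A\<close>; setting it to zero loses nothing and makes the determinant vanish.\<close>
  define B where "B = mat\<^sub>r m m (\<lambda>i. if i = m - 1 then 0\<^sub>v m else if i < r then row A i else 0\<^sub>v m)"
  have B: "B \<in> carrier_mat m m" by (simp add: B_def)
  have "det B = 0" unfolding B_def using assms by (intro det_row_0) auto
  then obtain v where v: "v \<in> carrier_vec m" "v \<noteq> 0\<^sub>v m" "B *\<^sub>v v = 0\<^sub>v m"
    using det_0_iff_vec_prod_zero_field[OF B] by blast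
  define x where "x = mat m 1 (\<lambda>(i, j). v $ i)"
  have x: "x \<in> carrier_mat m 1" by (simp add: x_def)
  obtain k where k: "k < m" "v $ k \<noteq> 0" using v by (metis carrier_vecD eq_vecI index_zero_vec)
  then have "x $$ (k, 0) \<noteq> 0" by (simp add: x_def)
  then have "x \<noteq> 0\<^sub>m m 1" using k by auto
  moreover have "A * x = 0\<^sub>m r 1"
  proof (rule eq_matI)
    fix i j assume "i < dim_row (0\<^sub>m r 1 :: complex mat)" "j < dim_col (0\<^sub>m r 1 :: complex mat)"
    then have i: "i < r" and j: "j = 0" by auto
    have "(B *\<^sub>v v) $ i = row B i \<bullet> v" using i assms B by simp
    moreover have "i \<noteq> m - 1" using i assms by linarith
    then have "row B i = row A i" using i assms by (simp add: B_def)
    ultimately have "row A i \<bullet> v = 0" using v(3) i assms by simp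
    moreover have "col x 0 = v" using v(1) by (intro eq_vecI) (auto simp: x_def)
    ultimately show "(A * x) $$ (i, j) = 0\<^sub>m r 1 $$ (i, j)" using i j A x by simp
  qed (use A x in auto)
  ultimately show ?thesis using x by blast
qed

text \<open>A left inverse forces a trivial kernel, which more columns than rows would
  contradict.\<close>

lemma isometry_mat_le:
  assumes "isometry_mat m r U"
  shows "r \<le> m"
proof (rule ccontr)
  assume "\<not> r \<le> m"
  have U: "U \<in> carrier_mat m r" "mat_adjoint U * U = 1\<^sub>m r"
    using assms by (auto simp: isometry_mat_def)
  obtain x where x: "x \<in> carrier_mat r 1" "x \<noteq> 0\<^sub>m r 1" "U * x = 0\<^sub>m m 1"
    using nontrivial_kernel[OF U(1)] \<open>\<not> r \<le> m\<close> by auto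
  have "mat_adjoint U * (U * x) = x"
    using assoc_mult_mat[OF mat_adjoint_carrier[OF U(1)] U(1) x(1)] U(2) x(1) by simp
  then show False using x right_mult_zero_mat[OF mat_adjoint_carrier[OF U(1)]] by simp
qed

text \<open>A nonzero kernel vector of U^H is orthogonal to all columns of \<open>U\<close>;
  normalised, it can be appended. The induction runs over the number of missing columns.\<close>

lemma isometry_mat_completion:
  assumes "isometry_mat m r U"
  shows "\<exists>W. isometry_mat m m W \<and> (\<forall>i<m. \<forall>j<r. W $$ (i, j) = U $$ (i, j))"
  using assms
proof (induction "m - r" arbitrary: r U)
  case 0
  then show ?case using isometry_mat_le[OF 0(2)] by auto
next
  case (Suc d)
  have U: "U \<in> carrier_mat m r" using Suc.prems by (simp add: isometry_mat_def)
  note U' = mat_adjoint_carrier[OF U]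
  obtain x where x: "x \<in> carrier_mat m 1" "x \<noteq> 0\<^sub>m m 1" "mat_adjoint U * x = 0\<^sub>m r 1"
    using nontrivial_kernel[OF U'] Suc.hyps(2) by (metis zero_less_Suc zero_less_diff)
  define a where "a = (\<Sum>k<m. (cmod (x $$ (k, 0)))\<^sup>2)"
  define w where "w = complex_of_real (1 / sqrt a) \<cdot>\<^sub>m x"
  have w: "isometry_mat m 1 w"
    unfolding w_def a_def using gram_col[OF x(1)] x(2) by (intro isometry_mat_normalize[OF x(1)]) auto
  have "mat_adjoint U * w = 0\<^sub>m r 1"
    unfolding w_def mult_smult_distrib[OF U' x(1)] x(3) by (intro eq_matI) auto
  note iso = isometry_mat_snoc_col[OF Suc.prems w this]
  have d: "d = m - Suc r" using Suc.hyps(2) by simp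
  obtain W where W: "isometry_mat m m W" "\<forall>i<m. \<forall>j<Suc r. W $$ (i, j) = snoc_col U w $$ (i, j)"
    using Suc.hyps(1)[OF d iso] by blast
  have "W $$ (i, j) = U $$ (i, j)" if "i < m" "j < r" for i j
    using W(2) that snoc_col_entry[OF U, of i j w] by simp
  then show ?case using W(1) by blast
qed

lemma isometry_mat_square:
  assumes "isometry_mat m m W"
  shows "W * mat_adjoint W = 1\<^sub>m m"
  using assms mat_mult_left_right_inverse[of "mat_adjoint W" m W] by (simp add: isometry_mat_def)

section \<open>Existence of the singular value decomposition\<close>

text \<open>The sum of the eigenvalues of $M^HM$ is its trace $\sum_{i,j} |M_{ij}|^2$, so they do not
  all vanish.\<close>

lemma gram_nonzero_eigenvector:
  fixes M :: "complex mat"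
  assumes M: "M \<in> carrier_mat m n" and "M \<noteq> 0\<^sub>m m n"
  shows "\<exists>e x. e \<noteq> 0 \<and> x \<in> carrier_mat n 1 \<and> x \<noteq> 0\<^sub>m n 1 \<and> mat_adjoint M * M * x = e \<cdot>\<^sub>m x"
proof -
  define H where "H = mat_adjoint M * M"
  note M' = mat_adjoint_carrier[OF M]
  have H: "H \<in> carrier_mat n n" unfolding H_def by (rule mult_carrier_mat[OF M' M])
  obtain es where es: "char_poly H = (\<Prod>e\<leftarrow>es. [:- e, 1:])"
    using char_poly_factorized[OF H] by blast
  obtain B P Q where "schur_decomposition H es = (B, P, Q)" by (cases "schur_decomposition H es")
  from schur_decomposition[OF H es this] have sim: "similar_mat_wit H B P Q" and diag: "diag_mat B = es"
    by auto
  note wit = similar_mat_witD2[OF H sim]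
  \<comment> \<open>Cyclicity of the trace moves the similarity factor \<open>P\<close> around, so
    \<open>H\<close> has the same trace as its Schur form \<open>B\<close>, whose diagonal lists the
    eigenvalues.\<close>
  have tr: "(\<Sum>i<n. (X * Y) $$ (i, i)) = (\<Sum>i<n. (Y * X) $$ (i, i))"
    if X: "X \<in> carrier_mat n n" and Y: "Y \<in> carrier_mat n n" for X Y :: "complex mat"
  proof -
    have "(\<Sum>i<n. (X * Y) $$ (i, i)) = (\<Sum>i<n. \<Sum>k<n. X $$ (i, k) * Y $$ (k, i))"
      by (intro sum.cong refl mult_mat_entry[OF X Y]) auto
    also have "\<dots> = (\<Sum>k<n. \<Sum>i<n. Y $$ (k, i) * X $$ (i, k))"
      by (subst sum.swap) (simp add: mult.commute)
    also have "\<dots> = (\<Sum>i<n. (Y * X) $$ (i, i))"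
      by (intro sum.cong refl mult_mat_entry[OF Y X, symmetric]) auto
    finally show ?thesis .
  qed
  have "(\<Sum>i<n. H $$ (i, i)) = (\<Sum>i<n. (B * Q * P) $$ (i, i))"
    using tr[OF wit(6) mult_carrier_mat[OF wit(5,7)]] wit(3) assoc_mult_mat[OF wit(6,5,7)] by simp
  also have "B * Q * P = B"
    using assoc_mult_mat[OF wit(5,7,6)] wit(2) right_mult_one_mat[OF wit(5)] by simp
  finally have trB: "(\<Sum>i<n. H $$ (i, i)) = (\<Sum>i<n. B $$ (i, i))" .
  have "\<exists>e\<in>set es. e \<noteq> 0"
  proof (rule ccontr)
    assume "\<not> (\<exists>e\<in>set es. e \<noteq> 0)"
    then have "B $$ (i, i) = 0" if "i < n" for i
      using that diag wit(5) by (auto simp: diag_mat_def)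
    then have "(\<Sum>i<n. H $$ (i, i)) = 0" using trB by simp
    moreover have "(\<Sum>i<n. H $$ (i, i)) = complex_of_real (\<Sum>i<n. \<Sum>k<m. (cmod (M $$ (k, i)))\<^sup>2)"
      unfolding H_def of_real_sum
    proof (intro sum.cong refl)
      fix i assume "i \<in> {..<n}"
      then have i: "i < n" by simp
      show "(mat_adjoint M * M) $$ (i, i) = (\<Sum>k<m. complex_of_real ((cmod (M $$ (k, i)))\<^sup>2))"
        unfolding mult_mat_entry[OF M' M i i]
        using i M by (intro sum.cong) (auto simp: complex_norm_square mult.commute simp flip: of_real_power)
    qed
    ultimately have "complex_of_real (\<Sum>i<n. \<Sum>k<m. (cmod (M $$ (k, i)))\<^sup>2) = 0" by simp
    then have "(\<Sum>i<n. \<Sum>k<m. (cmod (M $$ (k, i)))\<^sup>2) = 0" by (simp only: of_real_eq_0_iff)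
    then have "\<forall>i<n. \<forall>k<m. M $$ (k, i) = 0"
      by (subst (asm) sum_nonneg_eq_0_iff) (auto intro!: sum_nonneg simp: sum_nonneg_eq_0_iff)
    then have "M = 0\<^sub>m m n" using M by (intro eq_matI) auto
    then show False using assms(2) by simp
  qed
  then obtain e where e: "e \<in> set es" "e \<noteq> 0" by blast
  have "poly (char_poly H) e = 0"
    unfolding es poly_prod_list using e(1) by (auto simp: prod_list_zero_iff)
  then obtain v where v: "v \<in> carrier_vec n" "v \<noteq> 0\<^sub>v n" "H *\<^sub>v v = e \<cdot>\<^sub>v v"
    using eigenvalue_root_char_poly[OF H] H by (auto simp: eigenvalue_def eigenvector_def)
  define x where "x = mat n 1 (\<lambda>(i, j). v $ i)"
  have x: "x \<in> carrier_mat n 1" by (simp add: x_def)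
  obtain k where k: "k < n" "v $ k \<noteq> 0" using v by (metis carrier_vecD eq_vecI index_zero_vec)
  then have "x $$ (k, 0) \<noteq> 0" by (simp add: x_def)
  then have "x \<noteq> 0\<^sub>m n 1" using k by auto
  moreover have "H * x = e \<cdot>\<^sub>m x"
  proof (rule eq_matI)
    fix i j assume "i < dim_row (e \<cdot>\<^sub>m x)" "j < dim_col (e \<cdot>\<^sub>m x)"
    then have i: "i < n" and j: "j = 0" using x by auto
    have "row H i \<bullet> v = (e \<cdot>\<^sub>v v) $ i" using v(3) i H by (metis carrier_matD(1) index_mult_mat_vec)
    moreover have "col x 0 = v" using v(1) by (intro eq_vecI) (auto simp: x_def)
    ultimately show "(H * x) $$ (i, j) = (e \<cdot>\<^sub>m x) $$ (i, j)"
      using i j H x v(1) by (simp add: x_def)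
  qed (use H x in auto)
  ultimately show ?thesis using e(2) x unfolding H_def by blast
qed

text \<open>The SVD is built greedily: as long as $N = M - U \Sigma V^H$ is nonzero, a unit eigenvector $v$ of
  $N^HN$ for a nonzero eigenvalue and $u = Nv / \|Nv\|$ extend $V$ and $U$ by one column.\<close>

definition partial_SVD :: "complex mat \<Rightarrow> nat \<Rightarrow> complex mat \<Rightarrow> (nat \<Rightarrow> real) \<Rightarrow> complex mat \<Rightarrow> bool" where
  "partial_SVD M r U s V \<longleftrightarrow> isometry_mat (dim_row M) r U \<and> isometry_mat (dim_col M) r V \<and>
     (\<forall>i<r. s i > 0) \<and>
     M * V = U * mat_diag r (\<lambda>i. complex_of_real (s i)) \<and>
     mat_adjoint M * U = V * mat_diag r (\<lambda>i. complex_of_real (s i))"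

text \<open>Stated for a general matrix because it is applied to M with (V, U) and to M^H with (U,
  V).\<close>

lemma mult_snoc_col:
  fixes M :: "complex mat"
  assumes M: "M \<in> carrier_mat m n" and V: "V \<in> carrier_mat n r" and v: "v \<in> carrier_mat n 1"
    and U: "U \<in> carrier_mat m r" and u: "u \<in> carrier_mat m 1"
    and "M * V = U * mat_diag r d" "M * v = c \<cdot>\<^sub>m u"
  shows "M * snoc_col V v = snoc_col U u * mat_diag (Suc r) (d(r := c))"
proof (rule eq_matI)
  note sV = snoc_col_carrier[OF V, of v] and sU = snoc_col_carrier[OF U, of u]
  fix i j assume "i < dim_row (snoc_col U u * mat_diag (Suc r) (d(r := c)))"
    "j < dim_col (snoc_col U u * mat_diag (Suc r) (d(r := c)))"
  then have i: "i < m" and j: "j < Suc r" using U by (auto simp: snoc_col_def mat_diag_def)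
  have "(M * snoc_col V v) $$ (i, j) = (if j < r then (M * V) $$ (i, j) else (M * v) $$ (i, 0))"
    using i j mult_mat_entry[OF M V i, of j] mult_mat_entry[OF M v i, of 0]
    by (simp add: mult_mat_entry[OF M sV i j] snoc_col_entry[OF V _ j] del: index_mult_mat)
  also have "\<dots> = (if j < r then U $$ (i, j) * d j else c * u $$ (i, 0))"
    using i j u by (auto simp: assms(6,7) mat_diag_mult_right[OF U] simp del: index_mult_mat)
  also have "\<dots> = (snoc_col U u * mat_diag (Suc r) (d(r := c))) $$ (i, j)"
    unfolding mat_diag_mult_right[OF sU] using i j by (auto simp: snoc_col_entry[OF U])
  finally show "(M * snoc_col V v) $$ (i, j) = (snoc_col U u * mat_diag (Suc r) (d(r := c))) $$ (i, j)" .
qed (use M V U in \<open>auto simp: snoc_col_def mat_diag_def\<close>)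

lemma mat_adjoint_mat_diag_real:
  "mat_adjoint (mat_diag r (\<lambda>i. complex_of_real (s i))) = mat_diag r (\<lambda>i. complex_of_real (s i))"
  by (rule eq_matI) (auto simp: mat_diag_def)

lemma mat_adjoint_zero: "mat_adjoint (0\<^sub>m m n) = (0\<^sub>m n m :: complex mat)"
  by (rule eq_matI) auto

lemma mat_adjoint_minus:
  assumes "A \<in> carrier_mat m n" "B \<in> carrier_mat m n"
  shows "mat_adjoint (A - B) = mat_adjoint A - mat_adjoint (B :: complex mat)"
  using assms by (intro eq_matI) auto

text \<open>The two equations of \<open>partial_SVD\<close> say that the residual N kills the
  columns of V and N^H those of U. An eigenvector of N^H N with nonzero eigenvalue lies in the range
  of N^H and is thus orthogonal to V, while N x is orthogonal to U, so the new columns fit without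
  any Gram-Schmidt correction.\<close>

lemma partial_SVD_extend:
  assumes svd: "partial_SVD M r U s V"
    and ne: "M \<noteq> U * mat_diag r (\<lambda>i. complex_of_real (s i)) * mat_adjoint V"
  shows "\<exists>U s V. partial_SVD M (Suc r) U s V"
proof -
  define m n where "m = dim_row M" and "n = dim_col M"
  define D where "D = mat_diag r (\<lambda>i. complex_of_real (s i))"
  define N where "N = M - U * D * mat_adjoint V"
  have M: "M \<in> carrier_mat m n" by (simp add: m_def n_def)
  have D: "D \<in> carrier_mat r r" by (simp add: D_def)
  have U: "U \<in> carrier_mat m r" and V: "V \<in> carrier_mat n r"
    and UU: "mat_adjoint U * U = 1\<^sub>m r" and VV: "mat_adjoint V * V = 1\<^sub>m r"
    and isoU: "isometry_mat m r U" and isoV: "isometry_mat n r V"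
    and MV: "M * V = U * D" and MU: "mat_adjoint M * U = V * D" and pos: "\<forall>i<r. s i > 0"
    using svd by (auto simp: partial_SVD_def isometry_mat_def m_def n_def D_def)
  note U' = mat_adjoint_carrier[OF U] and V' = mat_adjoint_carrier[OF V] and M' = mat_adjoint_carrier[OF M]
  note UD = mult_carrier_mat[OF U D] and VD = mult_carrier_mat[OF V D]
  have N: "N \<in> carrier_mat m n" 
    unfolding N_def by (rule minus_carrier_mat[OF mult_carrier_mat[OF UD V']])
  note N' = mat_adjoint_carrier[OF N]
  have NV: "N * V = 0\<^sub>m m r"
    unfolding N_def minus_mult_distrib_mat[OF M mult_carrier_mat[OF UD V'] V] MV
      assoc_mult_mat[OF UD V' V] VV right_mult_one_mat[OF UD]
    using UD by (intro eq_matI) auto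
  have N_adj: "mat_adjoint N = mat_adjoint M - V * D * mat_adjoint U"
    unfolding N_def mat_adjoint_minus[OF M mult_carrier_mat[OF UD V']] mat_adjoint_mult[OF UD V']
      mat_adjoint_mult[OF U D] mat_adjoint_adjoint
    using assoc_mult_mat[OF V D U'] by (simp add: D_def mat_adjoint_mat_diag_real)
  have NU: "mat_adjoint N * U = 0\<^sub>m n r"
    unfolding N_adj minus_mult_distrib_mat[OF M' mult_carrier_mat[OF VD U'] U] MU
      assoc_mult_mat[OF VD U' U] UU right_mult_one_mat[OF VD]
    using VD by (intro eq_matI) auto
  have VN: "mat_adjoint V * mat_adjoint N = 0\<^sub>m r m"
    using mat_adjoint_mult[OF N V] by (simp add: NV mat_adjoint_zero)
  have UN: "mat_adjoint U * N = 0\<^sub>m r n"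
    using mat_adjoint_mult[OF N' U] by (simp add: NU mat_adjoint_zero)
  have "N \<noteq> 0\<^sub>m m n"
  proof
    assume N0: "N = 0\<^sub>m m n"
    note UDV = mult_carrier_mat[OF UD V']
    have "M = U * D * mat_adjoint V"
    proof (rule eq_matI)
      fix i j assume "i < dim_row (U * D * mat_adjoint V)" "j < dim_col (U * D * mat_adjoint V)"
      then have ij: "i < m" "j < n" using UDV by auto
      have "N $$ (i, j) = M $$ (i, j) - (U * D * mat_adjoint V) $$ (i, j)"
        unfolding N_def using ij UDV by (intro index_minus_mat(1)) auto
      then show "M $$ (i, j) = (U * D * mat_adjoint V) $$ (i, j)"
        using ij by (simp add: N0 del: index_mult_mat)
    qed (use M UDV in auto)
    then show False using ne by (simp add: D_def)
  qed
  then obtain e x where e: "e \<noteq> 0" and x: "x \<in> carrier_mat n 1" "x \<noteq> 0\<^sub>m n 1"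
    and ex: "mat_adjoint N * N * x = e \<cdot>\<^sub>m x"
    using gram_nonzero_eigenvector[OF N] by blast
  define y where "y = N * x"
  have y: "y \<in> carrier_mat m 1" unfolding y_def by (rule mult_carrier_mat[OF N x(1)])
  have Ny: "mat_adjoint N * y = e \<cdot>\<^sub>m x"
    unfolding y_def assoc_mult_mat[OF N' N x(1), symmetric] by (rule ex)
  have Uy: "mat_adjoint U * y = 0\<^sub>m r 1"
    unfolding y_def assoc_mult_mat[OF U' N x(1), symmetric] UN left_mult_zero_mat[OF x(1)] ..
  have "e \<cdot>\<^sub>m (mat_adjoint V * x) = mat_adjoint V * (mat_adjoint N * y)"
    unfolding Ny mult_smult_distrib[OF V' x(1)] ..
  also have "\<dots> = 0\<^sub>m r 1"
    unfolding assoc_mult_mat[OF V' N' y, symmetric] VN left_mult_zero_mat[OF y] ..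
  finally have eVx: "e \<cdot>\<^sub>m (mat_adjoint V * x) = 0\<^sub>m r 1" .
  have Vx: "mat_adjoint V * x = 0\<^sub>m r 1"
  proof (rule eq_matI)
    fix i j assume ij: "i < dim_row (0\<^sub>m r 1 :: complex mat)" "j < dim_col (0\<^sub>m r 1 :: complex mat)"
    then have "(e \<cdot>\<^sub>m (mat_adjoint V * x)) $$ (i, j) = e * (mat_adjoint V * x) $$ (i, j)"
      using mult_carrier_mat[OF V' x(1)] by (intro index_smult_mat(1)) auto
    then show "(mat_adjoint V * x) $$ (i, j) = 0\<^sub>m r 1 $$ (i, j)"
      using ij e by (simp add: eVx)
  qed (use V x in auto)
  define a b where "a = (\<Sum>k<n. (cmod (x $$ (k, 0)))\<^sup>2)" and "b = (\<Sum>k<m. (cmod (y $$ (k, 0)))\<^sup>2)"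
  note gx = gram_col[OF x(1), folded a_def] and gy = gram_col[OF y, folded b_def]
  have a: "a > 0" using gx(3) x(2) by simp
  \<comment> \<open>Comparing |N x|^2 with e |x|^2 shows that the complex number e is real and
    positive, without appeal to the spectral theory of Hermitian matrices.\<close>
  have "mat_adjoint y * y = mat_adjoint x * (mat_adjoint N * y)"
    unfolding y_def mat_adjoint_mult[OF N x(1)]
    by (rule assoc_mult_mat[OF mat_adjoint_carrier[OF x(1)] N' mult_carrier_mat[OF N x(1)]])
  also have "\<dots> = e \<cdot>\<^sub>m (mat_adjoint x * x)"
    unfolding Ny by (rule mult_smult_distrib[OF mat_adjoint_carrier[OF x(1)] x(1)])
  finally have "(mat 1 1 (\<lambda>_. complex_of_real b) :: complex mat) $$ (0, 0) =
      (e \<cdot>\<^sub>m mat 1 1 (\<lambda>_. complex_of_real a)) $$ (0, 0)"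
    unfolding gx(1) gy(1) by simp
  then have be: "complex_of_real b = e * complex_of_real a" by simp
  then have b: "b > 0" using gy(2) e a by (cases "b = 0") auto
  have e_eq: "e = complex_of_real (b / a)" using be a by (simp add: field_simps)
  \<comment> \<open>The quotient |N x| / |x|; after normalisation it satisfies both N v = \<sigma> u
    and N^H u = \<sigma> v.\<close>
  define \<sigma> where "\<sigma> = sqrt (b / a)"
  define u v where "u = complex_of_real (1 / sqrt b) \<cdot>\<^sub>m y" and "v = complex_of_real (1 / sqrt a) \<cdot>\<^sub>m x"
  have \<sigma>: "\<sigma> > 0" using a b by (simp add: \<sigma>_def)
  have iu: "isometry_mat m 1 u" and iv: "isometry_mat n 1 v"
    unfolding u_def v_def using isometry_mat_normalize[OF y gy(1) b] isometry_mat_normalize[OF x(1) gx(1) a] by auto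
  have u: "u \<in> carrier_mat m 1" and v: "v \<in> carrier_mat n 1"
    using iu iv by (auto simp: isometry_mat_def)
  have Uu: "mat_adjoint U * u = 0\<^sub>m r 1" and Vv: "mat_adjoint V * v = 0\<^sub>m r 1"
    unfolding u_def v_def mult_smult_distrib[OF U' y] mult_smult_distrib[OF V' x(1)] Uy Vx
    by (auto intro!: eq_matI)
  have smult_smult: "k \<cdot>\<^sub>m (l \<cdot>\<^sub>m A) = (k * l) \<cdot>\<^sub>m A" for k l and A :: "complex mat"
    by (intro eq_matI) auto
  have "1 / sqrt a = \<sigma> * (1 / sqrt b)"
    using b by (simp add: \<sigma>_def real_sqrt_divide)
  then have scale: "complex_of_real (1 / sqrt a) = complex_of_real \<sigma> * complex_of_real (1 / sqrt b)"
    by (metis of_real_mult)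
  have Nv: "N * v = complex_of_real \<sigma> \<cdot>\<^sub>m u"
    unfolding v_def u_def mult_smult_distrib[OF N x(1)] y_def[symmetric] smult_smult scale ..
  have "1 / sqrt b * (b / a) = \<sigma> * (1 / sqrt a)"
  proof -
    have "1 / sqrt b * (b / a) = (b / sqrt b) / a" by simp
    also have "b / sqrt b = sqrt b" using b by (simp add: real_div_sqrt)
    also have "sqrt b / a = sqrt b / (sqrt a * sqrt a)" using a by simp
    also have "\<dots> = \<sigma> * (1 / sqrt a)" by (simp add: \<sigma>_def real_sqrt_divide)
    finally show ?thesis .
  qed
  then have scale': "complex_of_real (1 / sqrt b) * complex_of_real (b / a) =
      complex_of_real \<sigma> * complex_of_real (1 / sqrt a)"
    by (metis of_real_mult)
  have Nu: "mat_adjoint N * u = complex_of_real \<sigma> \<cdot>\<^sub>m v"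
    unfolding v_def u_def mult_smult_distrib[OF N' y] Ny e_eq smult_smult scale' ..
  have minus_zero: "A - 0\<^sub>m k l = A" if "A \<in> carrier_mat k l" for k l and A :: "complex mat"
    using that by (intro eq_matI) auto
  \<comment> \<open>The part subtracted in N vanishes on vectors orthogonal to the old columns, so
    the relations carry over from N to M.\<close>
  have M_eq: "N * v = M * v"
    unfolding N_def minus_mult_distrib_mat[OF M mult_carrier_mat[OF UD V'] v]
      assoc_mult_mat[OF UD V' v] Vv right_mult_zero_mat[OF UD]
    by (rule minus_zero[OF mult_carrier_mat[OF M v]])
  have M_adj_eq: "mat_adjoint N * u = mat_adjoint M * u"
    unfolding N_adj minus_mult_distrib_mat[OF M' mult_carrier_mat[OF VD U'] u]
      assoc_mult_mat[OF VD U' u] Uu right_mult_zero_mat[OF VD]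
    by (rule minus_zero[OF mult_carrier_mat[OF M' u]])
  have upd: "(\<lambda>i. complex_of_real ((s(r := \<sigma>)) i)) = (\<lambda>i. complex_of_real (s i))(r := complex_of_real \<sigma>)"
    by auto
  have "partial_SVD M (Suc r) (snoc_col U u) (s(r := \<sigma>)) (snoc_col V v)"
    unfolding partial_SVD_def upd
    using isometry_mat_snoc_col[OF isoU iu Uu] isometry_mat_snoc_col[OF isoV iv Vv] pos \<sigma>
      mult_snoc_col[OF M V v U u MV[unfolded D_def] Nv[unfolded M_eq]]
      mult_snoc_col[OF M' U u V v MU[unfolded D_def] Nu[unfolded M_adj_eq]]
    by (auto simp: m_def n_def less_Suc_eq)
  then show ?thesis by blast
qed

text \<open>The number of columns is bounded by m, so a longest partial decomposition exists; a
  nonzero residual would let it be extended.\<close>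

lemma SVD_exists:
  fixes M :: "complex mat"
  assumes M: "M \<in> carrier_mat m n"
  obtains r U s V where "isometry_mat m r U" "isometry_mat n r V" "\<forall>i<r. s i > 0"
    "M = U * mat_diag r (\<lambda>i. complex_of_real (s i)) * mat_adjoint V"
proof -
  define P where "P r \<longleftrightarrow> (\<exists>U s V. partial_SVD M r U s V)" for r
  \<comment> \<open>The empty decomposition; the constant 1 is a filler, as there are no singular
    values yet.\<close>
  have "partial_SVD M 0 (0\<^sub>m m 0) (\<lambda>_. 1) (0\<^sub>m n 0)"
    using M by (auto simp: partial_SVD_def isometry_mat_def mat_diag_def intro!: eq_matI)
  then have "P 0" unfolding P_def by blast
  moreover have bound: "r \<le> m" if "P r" for r
    using that M isometry_mat_le by (auto simp: P_def partial_SVD_def)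
  ultimately have "P (Greatest P)" by (rule GreatestI_nat) 
  then obtain U s V where svd: "partial_SVD M (Greatest P) U s V" unfolding P_def by blast
  have eq: "M = U * mat_diag (Greatest P) (\<lambda>i. complex_of_real (s i)) * mat_adjoint V"
  proof (rule ccontr)
    assume "\<not> ?thesis"
    then have "P (Suc (Greatest P))" using partial_SVD_extend[OF svd] by (auto simp: P_def)
    then have "Suc (Greatest P) \<le> Greatest P" using bound by (rule Greatest_le_nat)
    then show False by simp
  qed
  have "isometry_mat m (Greatest P) U" "isometry_mat n (Greatest P) V" "\<forall>i<Greatest P. s i > 0"
    using svd unfolding partial_SVD_def carrier_matD[OF M] by blast+
  then show thesis using eq by (rule that)
qed

text \<open>The columns added in the completion meet only zero entries of \<open>S\<close>, so the
  product is unchanged.\<close>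

lemma full_SVD_exists:
  fixes M :: "complex mat"
  assumes M: "M \<in> carrier_mat m n"
  obtains U S V where "isometry_mat m m U" "isometry_mat n n V" "nonneg_diagonal m n S"
    "M = U * map_mat complex_of_real S * mat_adjoint V"
proof -
  obtain r U s V where U: "isometry_mat m r U" and V: "isometry_mat n r V" and s: "\<forall>i<r. s i > 0"
    and M_eq: "M = U * mat_diag r (\<lambda>i. complex_of_real (s i)) * mat_adjoint V"
    by (rule SVD_exists[OF M])
  obtain W where W: "isometry_mat m m W" "\<forall>i<m. \<forall>j<r. W $$ (i, j) = U $$ (i, j)"
    using isometry_mat_completion[OF U] by blast
  obtain Z where Z: "isometry_mat n n Z" "\<forall>i<n. \<forall>j<r. Z $$ (i, j) = V $$ (i, j)"
    using isometry_mat_completion[OF V] by blast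
  have Uc: "U \<in> carrier_mat m r" and Vc: "V \<in> carrier_mat n r" and Wc: "W \<in> carrier_mat m m"
    and Zc: "Z \<in> carrier_mat n n" using U V W Z by (auto simp: isometry_mat_def)
  have r: "r \<le> m" "r \<le> n" using isometry_mat_le U V by auto
  define S where "S = mat m n (\<lambda>(i, j). if i = j \<and> i < r then s i else 0)"
  have "nonneg_diagonal m n S"
    using s by (auto simp: nonneg_diagonal_def S_def diagonal_mat_def less_imp_le)
  moreover have "M = W * map_mat complex_of_real S * mat_adjoint Z"
  proof (rule eq_matI)
    have Sc: "map_mat complex_of_real S \<in> carrier_mat m n" by (simp add: S_def)
    note WS = mult_carrier_mat[OF Wc Sc]
    fix i j assume "i < dim_row (W * map_mat complex_of_real S * mat_adjoint Z)"
      "j < dim_col (W * map_mat complex_of_real S * mat_adjoint Z)"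
    then have i: "i < m" and j: "j < n" using Wc Zc by auto
    have WSe: "(W * map_mat complex_of_real S) $$ (i, k) = (if k < r then U $$ (i, k) * s k else 0)"
      if k: "k < n" for k
    proof -
      have "(W * map_mat complex_of_real S) $$ (i, k) =
          (\<Sum>l<m. if l = k then (if k < r then U $$ (i, k) * s k else 0) else 0)"
        unfolding mult_mat_entry[OF Wc Sc i k] using i k W by (intro sum.cong) (auto simp: S_def)
      also have "\<dots> = (if k < r then U $$ (i, k) * s k else 0)" using r by (simp add: sum.delta)
      finally show ?thesis .
    qed
    have "(W * map_mat complex_of_real S * mat_adjoint Z) $$ (i, j) =
        (\<Sum>k<n. if k \<in> {..<r} then U $$ (i, k) * s k * cnj (V $$ (j, k)) else 0)"
      unfolding mult_mat_entry[OF WS mat_adjoint_carrier[OF Zc] i j]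
      using Z Zc j WSe by (intro sum.cong) auto
    also have "\<dots> = (\<Sum>k<r. U $$ (i, k) * s k * cnj (V $$ (j, k)))"
      using r by (subst sum.inter_restrict[symmetric]) (auto intro!: sum.cong)
    also have "\<dots> = M $$ (i, j)"
      unfolding M_eq mat_diag_mult_right[OF Uc]
      by (subst mult_mat_entry[OF _ mat_adjoint_carrier[OF Vc] i j]) (use i j Vc in \<open>auto intro!: sum.cong\<close>)
    finally show "M $$ (i, j) = (W * map_mat complex_of_real S * mat_adjoint Z) $$ (i, j)" ..
  qed (use M Wc Zc in auto)
  ultimately show thesis by (rule that[OF W(1) Z(1)])
qed

section \<open>Generalized matrix functions\<close>

lemma mult_mat_diag_adjoint_entry:
  fixes U V :: "complex mat"
  assumes U: "U \<in> carrier_mat m r" and V: "V \<in> carrier_mat n r" and i: "i < m" and j: "j < n"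
  shows "(U * mat_diag r d * mat_adjoint V) $$ (i, j) = (\<Sum>k<r. U $$ (i, k) * d k * cnj (V $$ (j, k)))"
  unfolding mat_diag_mult_right[OF U]
  by (subst mult_mat_entry[OF _ mat_adjoint_carrier[OF V] i j]) (use i j V in \<open>auto intro!: sum.cong\<close>)

text \<open>\<open>compact_SVD\<close> fixes its size as the rank, so the length of the greedy
  construction has to be identified with it. M = U C and U = M C' give M and U the same column
  space, and the columns of an isometry are independent.\<close>

lemma rank_isometry_factorization:
  assumes U: "isometry_mat m r U" and V: "isometry_mat n r V" and s: "\<forall>i<r. s i > 0"
    and M_eq: "M = U * mat_diag r (\<lambda>i. complex_of_real (s i)) * mat_adjoint V"
  shows "vec_space.rank m M = r"
proof -
  interpret vec_space "TYPE(complex)" m .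
  let ?D = "mat_diag r (\<lambda>i. complex_of_real (s i))" and ?E = "mat_diag r (\<lambda>i. 1 / complex_of_real (s i))"
  have Uc: "U \<in> carrier_mat m r" and Vc: "V \<in> carrier_mat n r" and UU: "mat_adjoint U * U = 1\<^sub>m r"
    and VV: "mat_adjoint V * V = 1\<^sub>m r" using U V by (auto simp: isometry_mat_def)
  have D: "?D \<in> carrier_mat r r" and E: "?E \<in> carrier_mat r r" by simp_all
  note V' = mat_adjoint_carrier[OF Vc]
  define C where "C = ?D * mat_adjoint V"
  define C' where "C' = V * ?E"
  have C: "C \<in> carrier_mat r n" and C': "C' \<in> carrier_mat n r"
    unfolding C_def C'_def using mult_carrier_mat[OF D V'] mult_carrier_mat[OF Vc E] by auto
  have MUC: "M = U * C" unfolding M_eq C_def by (rule assoc_mult_mat[OF Uc D V'])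
  have M: "M \<in> carrier_mat m n" unfolding MUC by (rule mult_carrier_mat[OF Uc C])
  have "C * C' = ?D * (mat_adjoint V * (V * ?E))"
    unfolding C_def C'_def by (rule assoc_mult_mat[OF D V' mult_carrier_mat[OF Vc E]])
  also have "\<dots> = ?D * ?E"
    unfolding assoc_mult_mat[OF V' Vc E, symmetric] VV left_mult_one_mat[OF E] ..
  also have "\<dots> = 1\<^sub>m r" 
    unfolding mat_diag_diag using s by (intro eq_matI) (auto simp: mat_diag_def)
  finally have CC': "C * C' = 1\<^sub>m r" .
  have U_eq: "U = M * C'"
    unfolding MUC assoc_mult_mat[OF Uc C C'] CC' right_mult_one_mat[OF Uc] ..
  have "col_space M = col_space U"
  proof (intro equalityI subsetI)
    fix y assume "y \<in> col_space M"
    then obtain x where x: "x \<in> carrier_vec n" "y = M *\<^sub>v x" using M by (auto simp: col_space_eq[OF M])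
    then have "y = U *\<^sub>v (C *\<^sub>v x)" unfolding MUC using assoc_mult_mat_vec[OF Uc C x(1)] by simp
    then show "y \<in> col_space U"
      using mult_mat_vec_carrier[OF C x(1)] Uc by (auto simp: col_space_eq[OF Uc])
  next
    fix y assume "y \<in> col_space U"
    then obtain x where x: "x \<in> carrier_vec r" "y = U *\<^sub>v x" using Uc by (auto simp: col_space_eq[OF Uc])
    then have "y = M *\<^sub>v (C' *\<^sub>v x)" using assoc_mult_mat_vec[OF M C' x(1)] U_eq by simp
    then show "y \<in> col_space M"
      using mult_mat_vec_carrier[OF C' x(1)] M by (auto simp: col_space_eq[OF M])
  qed
  then have "rank M = rank U" by (simp add: rank_def col_space_def)
  \<comment> \<open>Linear independence concerns the set of columns, which would conceal
    repetitions; these are excluded first.\<close>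
  moreover have distinct: "distinct (cols U)"
  proof (unfold distinct_conv_nth, intro allI impI notI)
    fix i j assume ij: "i < length (cols U)" "j < length (cols U)" "i \<noteq> j" and eq: "cols U ! i = cols U ! j"
    then have *: "i < r" "j < r" using Uc by auto
    have "U $$ (k, i) = U $$ (k, j)" if "k < m" for k
      using eq * that Uc by (metis carrier_matD cols_nth index_col)
    then have "(\<Sum>k<m. cnj (U $$ (k, i)) * U $$ (k, i)) = (\<Sum>k<m. cnj (U $$ (k, i)) * U $$ (k, j))"
      by (intro sum.cong) auto
    then show False using U * ij(3) by (simp add: isometry_mat_iff)
  qed
  have "lin_indpt (set (cols U))"
  proof (rule ccontr)
    assume "\<not> lin_indpt (set (cols U))"
    then obtain v where v: "v \<in> carrier_vec r" "v \<noteq> 0\<^sub>v r" "U *\<^sub>v v = 0\<^sub>v m"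
      using lin_depE[OF Uc _ distinct] by blast
    have "v = mat_adjoint U *\<^sub>v (U *\<^sub>v v)"
      using assoc_mult_mat_vec[OF mat_adjoint_carrier[OF Uc] Uc v(1)] UU v(1) by simp
    also have "\<dots> = 0\<^sub>v r" unfolding v(3) using Uc by (intro eq_vecI) auto
    finally show False using v(2) by simp
  qed
  then have "rank U = r" by (rule lin_indpt_full_rank[OF Uc distinct])
  ultimately show ?thesis by simp
qed

lemma compact_SVD_exists:
  assumes M: "M \<in> carrier_mat m n"
  shows "\<exists>U \<sigma> V. compact_SVD M U \<sigma> V"
proof -
  obtain r U s V where U: "isometry_mat m r U" and V: "isometry_mat n r V" and s: "\<forall>i<r. s i > 0"
    and M_eq: "M = U * mat_diag r (\<lambda>i. complex_of_real (s i)) * mat_adjoint V"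
    by (rule SVD_exists[OF M])
  have Uc: "U \<in> carrier_mat m r" and Vc: "V \<in> carrier_mat n r"
    using U V by (auto simp: isometry_mat_def)
  \<comment> \<open>The greedy construction gives the singular values in no particular order;
    sorting the indices by \<open>- s i\<close> makes the values descend, and the columns of both
    factors are permuted alike.\<close>
  define xs where "xs = sort_key (\<lambda>i. - s i) [0..<r]"
  have xs: "length xs = r" "set xs = {..<r}" "distinct xs" "sorted (map (\<lambda>i. - s i) xs)"
    by (auto simp: xs_def)
  define perm where "perm W = mat (dim_row W) r (\<lambda>(i, j). W $$ (i, xs ! j))" for W :: "complex mat"
  have less: "xs ! k < r" if "k < r" for k using that xs nth_mem by fastforce
  have perm: "isometry_mat l r (perm W)" if "isometry_mat l r W" for l W
  proof -
    have "W \<in> carrier_mat l r" using that by (simp add: isometry_mat_def)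
    then show ?thesis
      using that less xs(1,3) unfolding isometry_mat_iff
      by (auto simp: perm_def nth_eq_iff_index_eq)
  qed
  define \<sigma> where "\<sigma> = map s xs"
  have pU: "perm U \<in> carrier_mat m r" and pV: "perm V \<in> carrier_mat n r"
    using Uc Vc by (auto simp: perm_def)
  have eq: "M = perm U * mat_diag r (\<lambda>i. complex_of_real (\<sigma> ! i)) * mat_adjoint (perm V)" (is "_ = ?R")
  proof (rule eq_matI)
    fix i j assume "i < dim_row ?R" "j < dim_col ?R"
    then have i: "i < m" and j: "j < n" using pU pV by auto
    have bij: "bij_betw ((!) xs) {..<r} {..<r}"
      by (rule bij_betw_nth[OF xs(3)]) (simp_all add: xs)
    have "M $$ (i, j) = (\<Sum>k<r. U $$ (i, k) * complex_of_real (s k) * cnj (V $$ (j, k)))"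
      unfolding M_eq by (rule mult_mat_diag_adjoint_entry[OF Uc Vc i j])
    also have "\<dots> = (\<Sum>k<r. U $$ (i, xs ! k) * complex_of_real (s (xs ! k)) * cnj (V $$ (j, xs ! k)))"
      by (rule sum.reindex_bij_betw[OF bij, symmetric])
    also have "\<dots> = ?R $$ (i, j)"
      unfolding mult_mat_diag_adjoint_entry[OF pU pV i j]
      using i j Uc Vc xs(1) by (intro sum.cong) (auto simp: perm_def \<sigma>_def)
    finally show "M $$ (i, j) = ?R $$ (i, j)" .
  qed (use M pU pV in auto)
  have pos: "\<forall>i<r. \<sigma> ! i > 0" using s less xs(1) by (simp add: \<sigma>_def)
  have rank: "vec_space.rank m M = r"
    by (rule rank_isometry_factorization[OF perm[OF U] perm[OF V] pos eq])
  have "sorted_wrt (\<ge>) \<sigma>"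
    using xs(4) by (simp add: \<sigma>_def sorted_wrt_map)
  moreover have "\<forall>x\<in>set \<sigma>. x > 0" using s xs(2) by (auto simp: \<sigma>_def)
  moreover have "length \<sigma> = r" by (simp add: \<sigma>_def xs(1))
  ultimately have "compact_SVD M (perm U) \<sigma> (perm V)"
    unfolding compact_SVD_def Let_def carrier_matD[OF M] rank
    using perm[OF U, unfolded isometry_mat_def] perm[OF V, unfolded isometry_mat_def] eq by blast
  then show ?thesis by blast
qed

text \<open>All values in \<sigma> are positive, so \<open>f_tilde\<close> applies \<open>f\<close>
  on the whole diagonal and keeps the zeros elsewhere.\<close>

lemma compact_SVD_monomial:
  assumes "compact_SVD M U \<sigma> V"
  shows "monomial_SVD M U (mat_diag (length \<sigma>) (\<lambda>i. \<sigma> ! i)) V"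
    and "mat_diag (length \<sigma>) (\<lambda>i. f (complex_of_real (\<sigma> ! i))) =
      f_tilde f (mat_diag (length \<sigma>) (\<lambda>i. \<sigma> ! i))"
proof -
  define r where "r = length \<sigma>"
  have pos: "\<sigma> ! i > 0" if "i < r" for i
    using assms that by (auto simp: compact_SVD_def Let_def r_def)
  have of_real: "map_mat complex_of_real (mat_diag r (\<lambda>i. \<sigma> ! i)) =
      mat_diag r (\<lambda>i. complex_of_real (\<sigma> ! i))"
    by (rule eq_matI) (auto simp: mat_diag_def)
  have "nonneg_monomial (mat_diag r (\<lambda>i. \<sigma> ! i))"
    using pos by (auto simp: nonneg_monomial_def mat_diag_def less_imp_le split: if_splits)
  moreover have "dim_row (mat_diag r (\<lambda>i. \<sigma> ! i)) = r" "dim_col (mat_diag r (\<lambda>i. \<sigma> ! i)) = r"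
    by (auto simp: mat_diag_def)
  ultimately show "monomial_SVD M U (mat_diag (length \<sigma>) (\<lambda>i. \<sigma> ! i)) V"
    using assms unfolding monomial_SVD_def r_def[symmetric] of_real
    by (auto simp: compact_SVD_def Let_def r_def)
  show "mat_diag (length \<sigma>) (\<lambda>i. f (complex_of_real (\<sigma> ! i))) =
      f_tilde f (mat_diag (length \<sigma>) (\<lambda>i. \<sigma> ! i))"
    using pos unfolding r_def[symmetric] f_tilde_def by (intro eq_matI) (auto simp: mat_diag_def)
qed

text \<open>This resolves the definite description: some compact SVD exists, and all of them agree
  with the given monomial decomposition, which need not be compact itself.\<close>

lemma gen_mat_fun_monomial_SVD:
  assumes "monomial_SVD M X D Y"
  shows "gen_mat_fun f M = X * f_tilde f D * mat_adjoint Y"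
  unfolding gen_mat_fun_def
proof (rule the_equality)
  have value_eq: "U * mat_diag (length \<sigma>) (\<lambda>i. f (complex_of_real (\<sigma> ! i))) * mat_adjoint V =
      X * f_tilde f D * mat_adjoint Y" if "compact_SVD M U \<sigma> V" for U \<sigma> V
    unfolding compact_SVD_monomial(2)[OF that]
    by (rule monomial_SVD_unique[OF compact_SVD_monomial(1)[OF that] assms])
  obtain U \<sigma> V where "compact_SVD M U \<sigma> V"
    using compact_SVD_exists[of M "dim_row M" "dim_col M"] by auto
  then show "\<exists>U \<sigma> V. compact_SVD M U \<sigma> V \<and>
      X * f_tilde f D * mat_adjoint Y =
      U * mat_diag (length \<sigma>) (\<lambda>i. f (complex_of_real (\<sigma> ! i))) * mat_adjoint V"
    using value_eq by metis
  show "N = X * f_tilde f D * mat_adjoint Y"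
    if "\<exists>U \<sigma> V. compact_SVD M U \<sigma> V \<and>
      N = U * mat_diag (length \<sigma>) (\<lambda>i. f (complex_of_real (\<sigma> ! i))) * mat_adjoint V" for N
    using that value_eq by auto
qed

section \<open>Generalized tensor functions\<close>

lemma map_mat_diag_block_mat:
  assumes Ds: "\<forall>D\<in>set Ds. D \<in> carrier_mat m n" and g: "g 0 = 0"
  shows "map_mat g (diag_block_mat Ds) = diag_block_mat (map (map_mat g) Ds)"
proof -
  have Gs: "\<forall>D\<in>set (map (map_mat g) Ds). D \<in> carrier_mat m n" using Ds by auto
  note d = diag_block_mat_equal_blocks[OF Ds]
    and e = diag_block_mat_equal_blocks[OF Gs, unfolded length_map]
  show ?thesis
  proof (rule eq_matI)
    fix i j assume "i < dim_row (diag_block_mat (map (map_mat g) Ds))"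
      "j < dim_col (diag_block_mat (map (map_mat g) Ds))"
    then have i: "i < length Ds * m" and j: "j < length Ds * n" using e(1) by auto
    have "Ds ! (i div m) \<in> carrier_mat m n" using Ds block_index_bounds(1)[OF i] by auto
    then show "map_mat g (diag_block_mat Ds) $$ (i, j) = diag_block_mat (map (map_mat g) Ds) $$ (i, j)"
      using i j d e(2)[OF i j] g block_index_bounds[OF i] block_index_bounds[OF j] by auto
  qed (use d(1) e(1) in auto)
qed

text \<open>At a nonzero entry, row and column have equal block number and equal offset, so each
  determines the other, even when m and n differ and the position is off the main diagonal.\<close>

lemma nonneg_monomial_diag_block_mat:
  assumes "\<forall>\<Sigma>\<in>set \<Sigma>s. nonneg_diagonal m n \<Sigma>"
  shows "nonneg_monomial (diag_block_mat \<Sigma>s)"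
proof -
  define D where "D = diag_block_mat \<Sigma>s"
  have Ds: "\<forall>\<Sigma>\<in>set \<Sigma>s. \<Sigma> \<in> carrier_mat m n" using assms by (auto simp: nonneg_diagonal_def)
  note d = diag_block_mat_equal_blocks[OF Ds, folded D_def]
  have entry: "D $$ (i, j) \<ge> 0 \<and> (D $$ (i, j) \<noteq> 0 \<longrightarrow> i div m = j div n \<and> i mod m = j mod n)"
    if i: "i < length \<Sigma>s * m" and j: "j < length \<Sigma>s * n" for i j
  proof -
    note bi = block_index_bounds[OF i] and bj = block_index_bounds[OF j]
    have \<Sigma>: "nonneg_diagonal m n (\<Sigma>s ! (i div m))" using assms bi(1) by simp
    then have "\<Sigma>s ! (i div m) \<in> carrier_mat m n" by (simp add: nonneg_diagonal_def)
    then have "\<Sigma>s ! (i div m) $$ (i mod m, j mod n) \<ge> 0"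
      "\<Sigma>s ! (i div m) $$ (i mod m, j mod n) \<noteq> 0 \<longrightarrow> i mod m = j mod n"
      using \<Sigma> bi(2) bj(2) unfolding nonneg_diagonal_def diagonal_mat_def
      by (cases "i mod m = j mod n"; auto)+
    then show ?thesis using d(2)[OF i j] by auto
  qed
  have eqI: "a = b" if "a div k = b div k" "a mod k = b mod k" for a b k :: nat
    using that by (metis div_mult_mod_eq)
  have dims: "dim_row D = length \<Sigma>s * m" "dim_col D = length \<Sigma>s * n" using d(1) by auto
  show ?thesis
    unfolding nonneg_monomial_def D_def[symmetric] dims
  proof (intro conjI allI impI)
    fix i j assume "i < length \<Sigma>s * m" "j < length \<Sigma>s * n"
    then show "D $$ (i, j) \<ge> 0" using entry by blast
  next
    fix i j k
    assume "i < length \<Sigma>s * m" "j < length \<Sigma>s * n" "k < length \<Sigma>s * n"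
      "D $$ (i, j) \<noteq> 0" "D $$ (i, k) \<noteq> 0"
    then have "j div n = k div n" "j mod n = k mod n" using entry[of i j] entry[of i k] by auto
    then show "j = k" by (rule eqI)
  next
    fix i k j
    assume "i < length \<Sigma>s * m" "k < length \<Sigma>s * m" "j < length \<Sigma>s * n"
      "D $$ (i, j) \<noteq> 0" "D $$ (k, j) \<noteq> 0"
    then have "i div m = k div m" "i mod m = k mod m" using entry[of i j] entry[of k j] by auto
    then show "i = k" by (rule eqI)
  qed
qed

text \<open>Multiplication and adjoints act block by block in Fourier form, so unitary blocks give a
  unitary tensor.\<close>

lemma unitary_fourier_tensor:
  assumes p: "p > 0" and len: "length Us = p" and Us: "\<forall>U\<in>set Us. isometry_mat k k U"
  shows "unitary_tensor k p (fourier_tensor k k p Us)"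
proof -
  have c: "\<forall>U\<in>set Us. U \<in> carrier_mat k k" and c': "\<forall>U\<in>set (map mat_adjoint Us). U \<in> carrier_mat k k"
    using Us by (auto simp: isometry_mat_def)
  have len': "length (map mat_adjoint Us) = p" using len by simp
  have "map2 (*) (map mat_adjoint Us) Us = replicate p (1\<^sub>m k)" "map2 (*) Us (map mat_adjoint Us) = replicate p (1\<^sub>m k)"
    using Us len isometry_mat_square by (auto simp: isometry_mat_def list_eq_iff_nth_eq)
  then show ?thesis
    unfolding unitary_tensor_iff[OF p fourier_tensor_tensors[OF p]] bcirc_fourier_tensor[OF p len c]
      mat_adjoint_fourier_block_diag[OF p len c]
      fourier_block_diag_mult[OF p len c len' c'] fourier_block_diag_mult[OF p len' c' len c]
    by (simp add: fourier_block_diag_one[OF p])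
qed

context
  fixes m n p :: nat and A :: tensor
  assumes A: "A \<in> tensors m n p" and p: "p > 0"
begin

text \<open>The right-hand side of the second conclusion mentions no T-SVD. Together with
  injectivity of \<open>bcirc\<close>, this yields both the independence of the tensor value from
  the T-SVD and the theorem itself.\<close>

lemma T_SVD_bcirc:
  fixes f :: "complex \<Rightarrow> complex"
  assumes svd: "T_SVD A U S V \<Sigma>s"
  defines "B \<equiv> U *\<^sub>T f_hat f (nrows A) (ncols A) \<Sigma>s *\<^sub>T tadjoint V"
  shows "B \<in> tensors m n p" "bcirc B = gen_mat_fun f (bcirc A)"
proof -
  note dA = tensors_dims[OF A p]
  have unitary: "unitary_tensor m p U" "unitary_tensor n p V" and S: "S \<in> tensors m n p"
    and len: "length \<Sigma>s = p" and \<Sigma>s: "\<forall>\<Sigma>\<in>set \<Sigma>s. nonneg_diagonal m n \<Sigma>"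
    and bS: "bcirc S = fourier_block_diag m n p (map (map_mat complex_of_real) \<Sigma>s)"
    and A_eq: "A = U *\<^sub>T S *\<^sub>T tadjoint V"
    using svd by (simp_all add: T_SVD_def Let_def dA)
  have U: "U \<in> tensors m m p" and V: "V \<in> tensors n n p"
    using unitary by (auto simp: unitary_tensor_def)
  note V' = tadjoint_bcirc[OF p V]
  have c: "\<forall>\<Sigma>\<in>set \<Sigma>s. \<Sigma> \<in> carrier_mat m n" using \<Sigma>s by (auto simp: nonneg_diagonal_def)
  have cf: "length (map (f_tilde f) \<Sigma>s) = p" "\<forall>D\<in>set (map (f_tilde f) \<Sigma>s). D \<in> carrier_mat m n"
    using c len by (auto simp: f_tilde_def)
  define D where "D = diag_block_mat \<Sigma>s"
  define K where "K k = dft_mat p \<otimes>\<^sub>K 1\<^sub>m k" for k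
  define X Y where "X = bcirc U * K m" and "Y = bcirc V * K n"
  have K: "K k \<in> carrier_mat (p * k) (p * k)" for k
    unfolding K_def by (rule kronecker_one_carrier[OF dft_mat_carrier])
  note K' = mat_adjoint_carrier[OF K]
  note bU = bcirc_carrier[OF p U] and bV = bcirc_carrier[OF p V]
  note bV' = mat_adjoint_carrier[OF bV]
  have D: "D \<in> carrier_mat (p * m) (p * n)"
    unfolding D_def using diag_block_mat_equal_blocks(1)[OF c] len by simp
  have dims: "dim_row D = p * m" "dim_col D = p * n" using D by auto
  have X: "X \<in> carrier_mat (p * m) (p * m)" and Y: "Y \<in> carrier_mat (p * n) (p * n)"
    unfolding X_def Y_def by (rule mult_carrier_mat[OF bU K] mult_carrier_mat[OF bV K])+
  have isometry: "mat_adjoint (bcirc Q * K k) * (bcirc Q * K k) = 1\<^sub>m (p * k)"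
    if Q: "unitary_tensor k p Q" for Q k
  proof -
    have Qt: "Q \<in> tensors k k p" using Q by (simp add: unitary_tensor_def)
    note bQ = bcirc_carrier[OF p Qt]
    have QQ: "mat_adjoint (bcirc Q) * bcirc Q = 1\<^sub>m (p * k)" using Q unitary_tensor_iff[OF p Qt] by simp
    have "mat_adjoint (bcirc Q * K k) * (bcirc Q * K k)
        = mat_adjoint (K k) * (mat_adjoint (bcirc Q) * (bcirc Q * K k))"
      unfolding mat_adjoint_mult[OF bQ K]
      by (rule assoc_mult_mat[OF K' mat_adjoint_carrier[OF bQ] mult_carrier_mat[OF bQ K]])
    also have "\<dots> = mat_adjoint (K k) * K k"
      unfolding assoc_mult_mat[OF mat_adjoint_carrier[OF bQ] bQ K, symmetric] QQ left_mult_one_mat[OF K] ..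
    also have "\<dots> = 1\<^sub>m (p * k)" unfolding K_def by (rule kronecker_dft_unitary(1)[OF p])
    finally show ?thesis .
  qed
  \<comment> \<open>Used twice: with E = D for \<open>A\<close>, and with E =
    \<open>f_tilde f D\<close> for \<open>B\<close>.\<close>
  have conj: "bcirc U * (K m * E * mat_adjoint (K n)) * mat_adjoint (bcirc V) = X * E * mat_adjoint Y"
    if E: "E \<in> carrier_mat (p * m) (p * n)" for E
  proof -
    note KE = mult_carrier_mat[OF K E]
    have "bcirc U * (K m * E * mat_adjoint (K n)) * mat_adjoint (bcirc V)
        = bcirc U * (K m * E) * mat_adjoint (K n) * mat_adjoint (bcirc V)"
      unfolding assoc_mult_mat[OF bU KE K'] ..
    also have "\<dots> = X * E * mat_adjoint (K n) * mat_adjoint (bcirc V)"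
      unfolding X_def assoc_mult_mat[OF bU K E] ..
    also have "\<dots> = X * E * (mat_adjoint (K n) * mat_adjoint (bcirc V))"
      by (rule assoc_mult_mat[OF mult_carrier_mat[OF X E] K' bV'])
    finally show ?thesis unfolding Y_def mat_adjoint_mult[OF bV K] .
  qed
  have blocks: "map_mat g D = diag_block_mat (map (map_mat g) \<Sigma>s)" if "g 0 = 0" for g :: "real \<Rightarrow> complex"
    unfolding D_def using map_mat_diag_block_mat[OF c, of g] that by simp
  have "bcirc A = bcirc U * bcirc S * mat_adjoint (bcirc V)"
    unfolding A_eq tprod_bcirc(2)[OF p tprod_bcirc(1)[OF p U S] V'(1)] tprod_bcirc(2)[OF p U S] V'(2) ..
  also have "\<dots> = X * map_mat complex_of_real D * mat_adjoint Y"
    unfolding bS fourier_block_diag_altdef[OF p] K_def[symmetric] blocks[of complex_of_real, OF of_real_0, symmetric]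
    by (rule conj) (use D in simp)
  finally have bA: "bcirc A = X * map_mat complex_of_real D * mat_adjoint Y" .
  have "monomial_SVD (bcirc A) X D Y"
    unfolding monomial_SVD_def dims carrier_matD[OF bcirc_carrier[OF p A]]
    using X Y isometry[OF unitary(1)] isometry[OF unitary(2)] bA nonneg_monomial_diag_block_mat[OF \<Sigma>s]
    by (simp add: X_def Y_def D_def)
  then have gen: "gen_mat_fun f (bcirc A) = X * f_tilde f D * mat_adjoint Y"
    by (rule gen_mat_fun_monomial_SVD)
  define F where "F = fourier_tensor m n p (map (f_tilde f) \<Sigma>s)"
  have F: "F \<in> tensors m n p" unfolding F_def by (rule fourier_tensor_tensors[OF p])
  have fhat: "f_hat f (nrows A) (ncols A) \<Sigma>s = F"
    unfolding f_hat_def len dA F_def by (rule bcirc_inv_fourier_block_diag[OF p cf])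
  have "f_tilde f D = diag_block_mat (map (f_tilde f) \<Sigma>s)"
    unfolding f_tilde_def by (rule blocks) simp
  then have bF: "bcirc F = K m * f_tilde f D * mat_adjoint (K n)"
    unfolding F_def bcirc_fourier_tensor[OF p cf] fourier_block_diag_altdef[OF p] K_def by simp
  show "B \<in> tensors m n p"
    unfolding B_def fhat by (rule tprod_bcirc(1)[OF p tprod_bcirc(1)[OF p U F] V'(1)])
  have "bcirc B = bcirc U * bcirc F * mat_adjoint (bcirc V)"
    unfolding B_def fhat tprod_bcirc(2)[OF p tprod_bcirc(1)[OF p U F] V'(1)] tprod_bcirc(2)[OF p U F] V'(2) ..
  also have "\<dots> = X * f_tilde f D * mat_adjoint Y"
    unfolding bF by (rule conj) (use D in \<open>simp add: f_tilde_def\<close>)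
  finally show "bcirc B = gen_mat_fun f (bcirc A)" using gen by simp
qed

lemma T_SVD_exists: "\<exists>U S V \<Sigma>s. T_SVD A U S V \<Sigma>s"
proof -
  obtain Ds where Ds: "length Ds = p" "\<forall>D\<in>set Ds. D \<in> carrier_mat m n" "A = fourier_tensor m n p Ds"
    by (rule fourier_tensor_surj[OF p A])
  have "\<exists>U S V. isometry_mat m m U \<and> isometry_mat n n V \<and> nonneg_diagonal m n S \<and>
      D = U * map_mat complex_of_real S * mat_adjoint V" if "D \<in> carrier_mat m n" for D
    by (rule full_SVD_exists[OF that]) blast
  then have "\<forall>D\<in>set Ds. \<exists>U S V. isometry_mat m m U \<and> isometry_mat n n V \<and> nonneg_diagonal m n S \<and>
      D = U * map_mat complex_of_real S * mat_adjoint V" using Ds(2) by blast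
  then obtain u s v where svd: "\<forall>D\<in>set Ds. isometry_mat m m (u D) \<and> isometry_mat n n (v D) \<and>
      nonneg_diagonal m n (s D) \<and> D = u D * map_mat complex_of_real (s D) * mat_adjoint (v D)"
    by metis
  define Us Vs \<Sigma>s where "Us = map u Ds" and "Vs = map v Ds" and "\<Sigma>s = map s Ds"
  define Ss where "Ss = map (map_mat complex_of_real) \<Sigma>s"
  have len: "length Us = p" "length Vs = p" "length \<Sigma>s = p" "length Ss = p" "length (map mat_adjoint Vs) = p"
    by (simp_all add: Us_def Vs_def \<Sigma>s_def Ss_def Ds(1))
  have iso: "\<forall>U\<in>set Us. isometry_mat m m U" "\<forall>V\<in>set Vs. isometry_mat n n V"
    and nn: "\<forall>\<Sigma>\<in>set \<Sigma>s. nonneg_diagonal m n \<Sigma>"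
    using svd by (auto simp: Us_def Vs_def \<Sigma>s_def)
  have c: "\<forall>U\<in>set Us. U \<in> carrier_mat m m" "\<forall>V\<in>set Vs. V \<in> carrier_mat n n"
    "\<forall>S\<in>set Ss. S \<in> carrier_mat m n" "\<forall>V\<in>set (map mat_adjoint Vs). V \<in> carrier_mat n n"
    using iso nn by (auto simp: isometry_mat_def nonneg_diagonal_def Ss_def)
  define U S V where "U = fourier_tensor m m p Us" and "S = fourier_tensor m n p Ss"
    and "V = fourier_tensor n n p Vs"
  have U: "U \<in> tensors m m p" and S: "S \<in> tensors m n p" and V: "V \<in> tensors n n p"
    unfolding U_def S_def V_def by (rule fourier_tensor_tensors[OF p])+
  have bS: "bcirc S = fourier_block_diag m n p Ss" unfolding S_def by (rule bcirc_fourier_tensor[OF p len(4) c(3)])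
  have cUS: "length (map2 (*) Us Ss) = p" "\<forall>D\<in>set (map2 (*) Us Ss). D \<in> carrier_mat m n"
    using c len by (auto simp: set_zip intro!: mult_carrier_mat)
  note V' = tadjoint_bcirc[OF p V]
  have "map2 (*) (map2 (*) Us Ss) (map mat_adjoint Vs) = Ds"
    using svd by (auto simp: Us_def Vs_def Ss_def \<Sigma>s_def list_eq_iff_nth_eq)
  then have "bcirc (U *\<^sub>T S *\<^sub>T tadjoint V) = bcirc A"
    unfolding tprod_bcirc(2)[OF p tprod_bcirc(1)[OF p U S] V'(1)] tprod_bcirc(2)[OF p U S] V'(2) bS
    unfolding U_def V_def Ds(3) bcirc_fourier_tensor[OF p len(1) c(1)] bcirc_fourier_tensor[OF p len(2) c(2)]
      bcirc_fourier_tensor[OF p Ds(1,2)] mat_adjoint_fourier_block_diag[OF p len(2) c(2)]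
      fourier_block_diag_mult[OF p len(1) c(1) len(4) c(3)] fourier_block_diag_mult[OF p cUS len(5) c(4)]
    by simp
  \<comment> \<open>The factorization is checked on the Fourier blocks and brought back by
    injectivity of \<open>bcirc\<close>.\<close>
  then have A_eq: "A = U *\<^sub>T S *\<^sub>T tadjoint V"
    using inj_onD[OF bcirc_inj[OF p] _ tprod_bcirc(1)[OF p tprod_bcirc(1)[OF p U S] V'(1)] A] by simp
  \<comment> \<open>Each slice of \<open>S\<close> is a linear combination of the blocks
    \<open>Ss\<close>, so it inherits their zeros off the diagonal.\<close>
  have zero: "Ss ! k $$ (i, j) = 0" if "k < p" "i < m" "j < n" "i \<noteq> j" for k i j
  proof -
    have "nonneg_diagonal m n (\<Sigma>s ! k)" using nn that len by simp
    then show ?thesis using that len by (auto simp: Ss_def nonneg_diagonal_def diagonal_mat_def)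
  qed
  have "F_diagonal S"
    by (auto simp: F_diagonal_def S_def fourier_tensor_def diagonal_mat_def zero)
  then have "T_SVD A U S V \<Sigma>s"
    unfolding T_SVD_def Let_def tensors_dims[OF A p]
    using unitary_fourier_tensor[OF p len(1) iso(1)] unitary_fourier_tensor[OF p len(2) iso(2)] S len nn bS A_eq
    by (simp add: U_def V_def Ss_def)
  then show ?thesis by blast
qed

end

theorem theorem14:
  fixes A :: tensor and f :: "complex \<Rightarrow> complex" and m n p :: nat
  assumes "A \<in> tensors m n p" and "p > 0"
  shows "gen_mat_fun f (bcirc A) = bcirc (gen_tensor_fun f A)"
proof -
  let ?value = "\<lambda>U V \<Sigma>s. U *\<^sub>T f_hat f (nrows A) (ncols A) \<Sigma>s *\<^sub>T tadjoint V"
  note val = T_SVD_bcirc[OF assms]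
  obtain U S V \<Sigma>s where svd: "T_SVD A U S V \<Sigma>s" using T_SVD_exists[OF assms] by blast
  have "gen_tensor_fun f A = ?value U V \<Sigma>s"
    unfolding gen_tensor_fun_def
  proof (rule the_equality)
    show "\<exists>U' S V' \<Sigma>s'. T_SVD A U' S V' \<Sigma>s' \<and> ?value U V \<Sigma>s = ?value U' V' \<Sigma>s'"
      using svd by blast
    \<comment> \<open>Any competing value has the same image under \<open>bcirc\<close>, namely the
      generalized matrix function of \<open>bcirc A\<close>.\<close>
    fix B assume "\<exists>U S V \<Sigma>s. T_SVD A U S V \<Sigma>s \<and> B = ?value U V \<Sigma>s"
    then have "B \<in> tensors m n p" "bcirc B = gen_mat_fun f (bcirc A)"
      using val[of _ _ _ _ f] by auto
    then show "B = ?value U V \<Sigma>s"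
      using inj_onD[OF bcirc_inj[OF assms(2)] _ _ val(1)[OF svd]] val(2)[OF svd, of f] by simp
  qed
  then show ?thesis using val(2)[OF svd, of f] by simp
qed

end
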